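(* Let $r$ and $s$ be coprime positive integers with $1\le s<r/2$, and let $k\ge 1$ be an integer. Then there exists a constant $N(r,s,k)$, depending only on $r,s,k$, such that for every integer $n\ge N(r,s,k)$ the coefficient of $q^n$ in the power series expansion of $$(-1)^{k}\,\frac{\sum_{j=k}^{\infty}(-1)^j q^{r j(j+1)/2}\left(q^{-sj}-q^{(j+1)s}\right)}{\left(q^s,q^{r-s};q^r\right)_{\infty}}$$ is nonnegative.
   Context: Notation: for $|q|<1$, $(a;q)_\infty=\prod_{n\ge 0}(1-aq^n)$ and $(a_1,\dots,a_m;q)_\infty=(a_1;q)_\infty\cdots(a_m;q)_\infty$. So $(q^s,q^{r-s};q^r)_\infty=\prod_{n\ge 0}(1-q^{s+rn})(1-q^{r-s+rn})$. *)

theory Defs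
  imports "HOL-Complex_Analysis.Complex_Analysis"
begin

definition qpoch_inf :: "complex \<Rightarrow> complex \<Rightarrow> complex" where
  "qpoch_inf a q = (\<Prod>n. 1 - a * q ^ n)"

definition qpoch_inf_list :: "complex list \<Rightarrow> complex \<Rightarrow> complex" where
  "qpoch_inf_list as q = (\<Prod>a\<leftarrow>as. qpoch_inf a q)"

text \<open>
  The natural-number exponent \<open>r * (j * (j + 1) div 2)\<close> is exact since \<open>j * (j + 1)\<close> is even.
  At \<open>q = 0\<close> the convention \<open>0 powi m = 0\<close> for \<open>m < 0\<close> gives the value \<open>0\<close> to every term
  with \<open>j \<ge> 1\<close>; this is the continuous extension when \<open>2 * s < r\<close>, because then the total
  exponent \<open>r * j * (j + 1) / 2 - s * j\<close> is positive.
\<close>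
definition truncated_theta :: "nat \<Rightarrow> nat \<Rightarrow> nat \<Rightarrow> complex \<Rightarrow> complex" where
  "truncated_theta r s k q =
     (\<Sum>\<^sub>\<infinity>j\<in>{k..}. (-1) ^ j * q ^ (r * (j * (j + 1) div 2)) *
        (q powi (- (int s * int j)) - q ^ ((j + 1) * s)))"

definition truncated_quotient :: "nat \<Rightarrow> nat \<Rightarrow> nat \<Rightarrow> complex \<Rightarrow> complex" where
  "truncated_quotient r s k q =
     (-1) ^ k * (truncated_theta r s k q / qpoch_inf_list [q ^ s, q ^ (r - s)] (q ^ r))"

end

theory Submission
  imports Defs
begin

text \<open>
  By the Jacobi triple product, the full series (\<open>k = 0\<close>) divided by
  \<open>(q\<^sup>s, q\<^sup>r\<^sup>-\<^sup>s; q\<^sup>r)\<^sub>\<infinity>\<close> equals \<open>(q\<^sup>r; q\<^sup>r)\<^sub>\<infinity>\<close>, whose coefficients are bounded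
  (pentagonal numbers, i.e. the triple product for \<open>(3r, r)\<close>). The quotient in question is therefore
  this bounded series up to sign plus \<open>Q G\<close>, where \<open>G = (1 - q\<^sup>s) / (q\<^sup>s, q\<^sup>r\<^sup>-\<^sup>s; q\<^sup>r)\<^sub>\<infinity>\<close> counts
  partitions into parts \<open>\<plusminus>s\<close> modulo \<open>r\<close> other than \<open>s\<close>, and \<open>Q\<close> is a polynomial with
  \<open>Q(1) = k\<close>. So it suffices that the coefficients of \<open>G\<close> satisfy \<open>g(n) \<rightarrow> \<infinity>\<close> and
  \<open>g(n - 1) / g(n) \<rightarrow> 1\<close> (a case of a theorem of Bateman and Erdos). For this, split off the two
  coprime parts \<open>r - s\<close> and \<open>2r - s\<close>: \<open>G = B C\<close>, where the coefficients of \<open>B\<close> grow linearly while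
  their differences are bounded. The logarithmic derivative of \<open>C\<close> has coefficients
  \<open>O(n log n)\<close>, which forces \<open>c(n - i) = o(g(n))\<close> for every \<open>i\<close>, and the claim follows by
  convolution.
\<close>

unbundle no vec_syntax

subsection \<open>Infinite products of formal power series\<close>

text \<open>Convergence of formal power series means that each coefficient is eventually constant,
  and coefficient \<open>n\<close> of a product involves only the coefficients up to
  \<open>n\<close> of its factors.\<close>

lemma tendsto_mult_fps:
  fixes a b :: "'a::ring_1 fps"
  assumes "(f \<longlongrightarrow> a) F" "(g \<longlongrightarrow> b) F"
  shows "((\<lambda>x. f x * g x) \<longlongrightarrow> a * b) F"
  unfolding tendsto_fps_iff
proof
  fix n :: nat
  have "eventually (\<lambda>x. \<forall>i\<in>{..n}. f x $ i = a $ i) F" "eventually (\<lambda>x. \<forall>i\<in>{..n}. g x $ i = b $ i) F"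
    using assms by (auto simp: tendsto_fps_iff eventually_ball_finite)
  then show "eventually (\<lambda>x. (f x * g x) $ n = (a * b) $ n) F"
    by eventually_elim (simp add: fps_mult_nth)
qed

lemma tendsto_fps_deriv:
  fixes a :: "'a::ring_1 fps"
  assumes "(f \<longlongrightarrow> a) F"
  shows "((\<lambda>x. fps_deriv (f x)) \<longlongrightarrow> fps_deriv a) F"
  unfolding tendsto_fps_iff
proof
  fix n :: nat
  have "eventually (\<lambda>x. f x $ (n + 1) = a $ (n + 1)) F"
    using assms by (auto simp: tendsto_fps_iff)
  then show "eventually (\<lambda>x. fps_deriv (f x) $ n = fps_deriv a $ n) F"
    by eventually_elim simp
qed

text \<open>Each factor alters the product so far by a multiple of \<open>fps_X ^ e i\<close>, which
  starts above degree \<open>n\<close>.\<close>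

lemma fps_nth_prod_one_minus_X_power:
  fixes e :: "'b \<Rightarrow> nat"
  assumes "finite A" "\<And>i. i \<in> A \<Longrightarrow> n < e i"
  shows "(F * (\<Prod>i\<in>A. 1 - fps_X ^ e i)) $ n = (F :: 'a::comm_ring_1 fps) $ n"
  using assms
proof (induction A rule: finite_induct)
  case (insert a A)
  have "F * (\<Prod>i\<in>insert a A. 1 - fps_X ^ e i)
      = F * (\<Prod>i\<in>A. 1 - fps_X ^ e i) - F * (\<Prod>i\<in>A. 1 - fps_X ^ e i) * fps_X ^ e a"
    using insert by (simp add: algebra_simps)
  then show ?case
    using insert by (simp only: fps_sub_nth fps_X_power_mult_right_nth) simp
qed simp

text \<open>The infinite product of the factors \<open>1 - fps_X ^ f i\<close>. Reading coefficient
  \<open>n\<close> off the factors with \<open>i \<le> n\<close> is correct when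
  \<open>i < f i\<close>, since the later factors leave that coefficient alone.\<close>

definition euler_fps :: "(nat \<Rightarrow> nat) \<Rightarrow> 'a::comm_ring_1 fps" where
  "euler_fps f = Abs_fps (\<lambda>n. (\<Prod>i\<le>n. 1 - fps_X ^ f i) $ n)"

lemma euler_fps_nth:
  assumes "\<And>i. i < f i" "n < N"
  shows "(\<Prod>i<N. 1 - fps_X ^ f i) $ n = (euler_fps f :: 'a::comm_ring_1 fps) $ n"
proof -
  have *: "{..<N} = {..n} \<union> {n<..<N}"
    using assms(2) by auto
  have "(\<Prod>i<N. 1 - fps_X ^ f i :: 'a fps) = (\<Prod>i\<le>n. 1 - fps_X ^ f i) * (\<Prod>i\<in>{n<..<N}. 1 - fps_X ^ f i)"
    unfolding * by (intro prod.union_disjoint) auto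
  moreover have "(\<dots>) $ n = (\<Prod>i\<le>n. 1 - fps_X ^ f i :: 'a fps) $ n"
    using assms(1) by (intro fps_nth_prod_one_minus_X_power) (auto intro: order.strict_trans[OF _ assms(1)])
  ultimately show ?thesis
    by (simp add: euler_fps_def)
qed

lemma tendsto_euler_fps:
  assumes "\<And>i. i < f i"
  shows "(\<lambda>N. \<Prod>i<N. 1 - fps_X ^ f i) \<longlonglongrightarrow> (euler_fps f :: 'a::comm_ring_1 fps)"
proof (rule tendsto_fpsI)
  fix n :: nat
  have "(\<Prod>i<N. 1 - fps_X ^ f i) $ n = (euler_fps f :: 'a fps) $ n" if "N > n" for N
    using that by (intro euler_fps_nth assms)
  then show "\<forall>\<^sub>F N in sequentially. (\<Prod>i<N. 1 - fps_X ^ f i) $ n = (euler_fps f :: 'a fps) $ n"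
    unfolding eventually_at_top_dense by blast
qed

lemma euler_fps_nth_0 [simp]:
  assumes "\<And>i. i < f i"
  shows "(euler_fps f :: 'a::comm_ring_1 fps) $ 0 = 1"
  using assms[of 0] by (simp add: euler_fps_def)

lemma euler_fps_Suc:
  assumes "\<And>i. i < f i"
  shows "(euler_fps f :: 'a::comm_ring_1 fps) = (1 - fps_X ^ f 0) * euler_fps (\<lambda>i. f (Suc i))"
proof (rule LIMSEQ_unique)
  show "(\<lambda>N. \<Prod>i<Suc N. 1 - fps_X ^ f i) \<longlonglongrightarrow> (euler_fps f :: 'a fps)"
    by (rule LIMSEQ_Suc[OF tendsto_euler_fps[OF assms]])
  have "(\<lambda>N. (1 - fps_X ^ f 0) * (\<Prod>i<N. 1 - fps_X ^ f (Suc i)))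
      \<longlonglongrightarrow> ((1 - fps_X ^ f 0) * euler_fps (\<lambda>i. f (Suc i)) :: 'a fps)"
    by (intro tendsto_mult_fps tendsto_const tendsto_euler_fps) (rule Suc_lessD[OF assms])
  then show "(\<lambda>N. \<Prod>i<Suc N. 1 - fps_X ^ f i)
      \<longlonglongrightarrow> ((1 - fps_X ^ f 0) * euler_fps (\<lambda>i. f (Suc i)) :: 'a fps)"
    by (simp add: prod.lessThan_Suc_shift del: prod.lessThan_Suc)
qed

section \<open>Logarithmic derivatives of the products\<close>

text \<open>For \<open>i < f i\<close> this is \<open>- X P' / P\<close> with
  \<open>P = euler_fps f\<close>. The bound \<open>i < m\<close> keeps the index set finite; for
  \<open>m > 0\<close> it follows from \<open>f i dvd m\<close>, so no divisor is lost.\<close>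

definition sigma_fps :: "(nat \<Rightarrow> nat) \<Rightarrow> 'a::comm_ring_1 fps" where
  "sigma_fps f = Abs_fps (\<lambda>m. \<Sum>i | i < m \<and> f i dvd m. of_nat (f i))"

lemma inverse_one_minus_X_power_nth:
  assumes "d > 0"
  shows "inverse (1 - fps_X ^ d :: 'a::field fps) $ n = of_bool (d dvd n)"
proof -
  have "(1 - fps_X ^ d) * Abs_fps (\<lambda>n. of_bool (d dvd n)) = (1 :: 'a fps)"
  proof (rule fps_ext)
    fix n
    have "d dvd n - d \<longleftrightarrow> d dvd n" if "d \<le> n"
      using that by (metis dvd_minus_self not_less)
    moreover have "n = 0 \<longleftrightarrow> d dvd n" if "n < d"
      using that by (auto dest: dvd_imp_le)
    ultimately show "((1 - fps_X ^ d) * Abs_fps (\<lambda>n. of_bool (d dvd n))) $ n = (1 :: 'a fps) $ n"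
      using assms by (cases "n < d") (auto simp: left_diff_distrib fps_X_power_mult_nth)
  qed
  then have "inverse (1 - fps_X ^ d :: 'a fps) = Abs_fps (\<lambda>n. of_bool (d dvd n))"
    using fps_inverse_unique by metis
  then show ?thesis by simp
qed

text \<open>Here \<open>X^d / (1 - X^d)\<close> is written as \<open>inverse (1 - X^d) - 1\<close>,
  whose coefficients come from the geometric series.\<close>

lemma deriv_one_minus_X_power:
  assumes "d > 0"
  shows "fps_X * fps_deriv (1 - fps_X ^ d :: 'a::field fps)
       = - (1 - fps_X ^ d) * (of_nat d * (inverse (1 - fps_X ^ d) - 1))"
proof -
  have "(1 - fps_X ^ d :: 'a fps) $ 0 \<noteq> 0"
    using assms by simp
  then have inv: "(1 - fps_X ^ d :: 'a fps) * inverse (1 - fps_X ^ d) = 1"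
    by (simp add: inverse_mult_eq_1')
  have "fps_X * fps_deriv (1 - fps_X ^ d :: 'a fps) = - (of_nat d * (fps_X ^ (d - 1) * fps_X))"
  proof -
    have "fps_deriv (1 - fps_X ^ d :: 'a fps) = - (of_nat d * fps_X ^ (d - 1))"
      by (simp add: fps_deriv_power')
    moreover have alg: "a * - (b * c) = - (b * (c * a))" for a b c :: "'a fps"
      by (simp add: algebra_simps)
    ultimately show ?thesis
      by (simp only: alg)
  qed
  also have "\<dots> = - (of_nat d * fps_X ^ d)"
    using assms by (simp only: power_minus_mult)
  also have "\<dots> = - (1 - fps_X ^ d) * (of_nat d * (inverse (1 - fps_X ^ d) - 1))"
  proof -
    have "fps_X ^ d = (1 - fps_X ^ d :: 'a fps) * inverse (1 - fps_X ^ d) - (1 - fps_X ^ d)"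
      unfolding inv by simp
    moreover have alg: "- (n * x) = - p * (n * (i - 1))" if "x = p * i - p" for n p i x :: "'a fps"
      unfolding that by (simp add: algebra_simps)
    ultimately show ?thesis by (intro alg)
  qed
  finally show ?thesis .
qed

text \<open>For finite products the logarithmic derivative is the sum over the factors; both sides
  are compatible with coefficientwise limits.\<close>

lemma euler_fps_log_deriv:
  assumes "\<And>i. i < f i"
  shows "fps_X * fps_deriv (euler_fps f) = - (euler_fps f * (sigma_fps f :: 'a::field fps))"
proof (rule LIMSEQ_unique)
  let ?P = "\<lambda>N. \<Prod>i<N. 1 - fps_X ^ f i :: 'a fps"
  let ?S = "\<lambda>N. \<Sum>i<N. of_nat (f i) * (inverse (1 - fps_X ^ f i) - 1) :: 'a fps"
  have pos: "f i > 0" for i using assms[of i] by simp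
  show "(\<lambda>N. fps_X * fps_deriv (?P N)) \<longlonglongrightarrow> fps_X * fps_deriv (euler_fps f)"
    by (intro tendsto_mult_fps tendsto_fps_deriv tendsto_euler_fps assms tendsto_const)
  have "?S \<longlonglongrightarrow> sigma_fps f"
    unfolding tendsto_fps_iff eventually_sequentially
  proof (intro allI exI impI)
    fix n N :: nat assume N: "n \<le> N"
    have coeff: "(of_nat (f i) * (inverse (1 - fps_X ^ f i) - 1) :: 'a fps) $ n
       = (if i < n \<and> f i dvd n then of_nat (f i) else 0)" for i
      using assms[of i] pos[of i] dvd_imp_le[of "f i" n]
      by (auto simp: fps_of_nat[symmetric] inverse_one_minus_X_power_nth)
    have "?S N $ n = (\<Sum>i<N. if i < n \<and> f i dvd n then of_nat (f i) else 0)"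
      by (simp only: fps_sum_nth coeff)
    also have "\<dots> = (\<Sum>i | i < n \<and> f i dvd n. of_nat (f i))"
      using N by (intro sum.mono_neutral_cong_right) auto
    finally show "?S N $ n = sigma_fps f $ n"
      by (simp add: sigma_fps_def)
  qed
  then have "(\<lambda>N. - 1 * (?P N * ?S N)) \<longlonglongrightarrow> - 1 * (euler_fps f * sigma_fps f)"
    by (intro tendsto_mult_fps tendsto_euler_fps assms tendsto_const)
  moreover have "fps_X * fps_deriv (?P N) = - 1 * (?P N * ?S N)" for N
  proof (induction N)
    case (Suc N)
    have alg: "a * (u * v' + u' * v) = u * (a * v') + a * u' * v" for a u u' v v' :: "'a fps"
      by (simp add: algebra_simps)
    have alg': "p * (- q * t) + - 1 * (p * s) * q = - 1 * (p * q * (s + t))" for p q s t :: "'a fps"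
      by (simp add: algebra_simps)
    have "fps_X * fps_deriv (?P (Suc N))
        = ?P N * (fps_X * fps_deriv (1 - fps_X ^ f N)) + fps_X * fps_deriv (?P N) * (1 - fps_X ^ f N)"
      by (simp only: prod.lessThan_Suc fps_deriv_mult alg)
    also have "\<dots> = - 1 * (?P (Suc N) * ?S (Suc N))"
      unfolding Suc.IH deriv_one_minus_X_power[OF pos] prod.lessThan_Suc sum.lessThan_Suc
      by (rule alg')
    finally show ?case .
  qed simp
  ultimately show "(\<lambda>N. fps_X * fps_deriv (?P N)) \<longlonglongrightarrow> - (euler_fps f * sigma_fps f)"
    by simp
qed

text \<open>Injectivity makes this a sum over distinct divisors of \<open>m\<close>. Exchanging
  \<open>d\<close> with \<open>m / d\<close> gives \<open>m\<close> times a sum of reciprocals of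
  divisors, bounded by the harmonic number.\<close>

lemma sigma_fps_nth_le:
  assumes "inj f" "\<And>i. i < f i"
  shows "(sigma_fps f :: real fps) $ m \<le> real m * harm m"
proof (cases "m = 0")
  case False
  have "(sigma_fps f :: real fps) $ m = (\<Sum>d\<in>f ` {i. i < m \<and> f i dvd m}. real d)"
    using assms(1) by (subst sum.reindex) (auto simp: sigma_fps_def inj_def inj_on_def)
  also have "\<dots> \<le> (\<Sum>d | d dvd m. real d)"
    using False by (intro sum_mono2) (auto)
  also have "\<dots> = (\<Sum>d | d dvd m. real (m div d))"
    using False by (intro sum.reindex_bij_witness[of _ "\<lambda>d. m div d" "\<lambda>d. m div d"])
      (auto simp: dvd_div_eq_0_iff div_div_eq_right div_dvd_iff_mult)
  also have "\<dots> = (\<Sum>d | d dvd m. real m * inverse (real d))"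
    by (intro sum.cong) (auto simp: real_of_nat_div field_simps)
  also have "\<dots> \<le> (\<Sum>d = 1..m. real m * inverse (real d))"
    using False by (intro sum_mono2) (auto intro: Nat.gr0I dvd_imp_le simp: Suc_le_eq)
  also have "\<dots> = real m * harm m"
    by (simp add: harm_def sum_distrib_left)
  finally show ?thesis .
qed (simp add: sigma_fps_def)

lemma sigma_fps_nth_nonneg: "(sigma_fps f :: real fps) $ m \<ge> 0"
  by (auto simp: sigma_fps_def intro!: sum_nonneg)

subsection \<open>The Jacobi triple product\<close>

text \<open>The Pascal recursion avoids division, so the definition makes sense in every commutative
  ring.\<close>

fun qbinomial :: "'a::comm_ring_1 \<Rightarrow> nat \<Rightarrow> nat \<Rightarrow> 'a" where
  "qbinomial q n 0 = 1"
| "qbinomial q 0 (Suc k) = 0"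
| "qbinomial q (Suc n) (Suc k) = qbinomial q n k + q ^ Suc k * qbinomial q n (Suc k)"

lemma qbinomial_eq_0: "n < k \<Longrightarrow> qbinomial q n k = 0"
  by (induction q n k rule: qbinomial.induct) auto

lemma choose_two_Suc: "Suc n choose 2 = (n choose 2) + n"
  by (simp add: numeral_2_eq_2)

lemma choose_two_add: "(m + n) choose 2 = (m choose 2) + (n choose 2) + m * n"
  by (induction n) (simp_all add: choose_two_Suc numeral_2_eq_2)

lemma choose_two_square: "2 * (n choose 2) + n = n * n"
  by (induction n) (simp_all add: choose_two_Suc numeral_2_eq_2)

text \<open>The form homogeneous in \<open>a\<close> and \<open>b\<close> later allows
  \<open>a = Q ^ m\<close> in place of negative powers. Splitting off the factor
  \<open>i = 0\<close> turns \<open>b\<close> into \<open>b * q\<close>, hence the induction over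
  all \<open>b\<close>.\<close>

lemma qbinomial_theorem:
  "(\<Prod>i<n. a + b * q ^ i)
     = (\<Sum>k\<le>n. qbinomial q n k * q ^ (k choose 2) * b ^ k * a ^ (n - k))"
proof (induction n arbitrary: b)
  case (Suc n)
  let ?t = "\<lambda>k. qbinomial q n k * q ^ (k choose 2) * (b * q) ^ k * a ^ (n - k)"
  have "(\<Prod>i<Suc n. a + b * q ^ i) = (a + b) * (\<Prod>i<n. a + (b * q) * q ^ i)"
    by (simp add: prod.lessThan_Suc_shift mult_ac del: prod.lessThan_Suc)
  also have "\<dots> = a * (\<Sum>k\<le>n. ?t k) + b * (\<Sum>k\<le>n. ?t k)"
    unfolding Suc.IH by (rule distrib_right)
  also have "a * (\<Sum>k\<le>n. ?t k) = (\<Sum>k\<le>Suc n. qbinomial q n k * q ^ (k choose 2) * (b * q) ^ k * a ^ (Suc n - k))"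
    by (simp add: sum_distrib_left qbinomial_eq_0 Suc_diff_le mult_ac)
  also have "\<dots> = a ^ Suc n + (\<Sum>k\<le>n. qbinomial q n (Suc k) * q ^ (Suc k choose 2) * (b * q) ^ Suc k * a ^ (n - k))"
    by (subst sum.atMost_Suc_shift) (simp add: binomial_eq_0)
  also have "\<dots> + b * (\<Sum>k\<le>n. ?t k)
      = a ^ Suc n + (\<Sum>k\<le>n. qbinomial q (Suc n) (Suc k) * q ^ (Suc k choose 2) * b ^ Suc k * a ^ (n - k))"
    by (simp add: sum_distrib_left sum.distrib[symmetric] choose_two_Suc power_add power_mult_distrib algebra_simps)
  also have "\<dots> = (\<Sum>k\<le>Suc n. qbinomial q (Suc n) k * q ^ (k choose 2) * b ^ k * a ^ (Suc n - k))"
    by (subst sum.atMost_Suc_shift) (simp add: binomial_eq_0)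
  finally show ?case .
qed (simp add: binomial_eq_0)

definition qfact :: "'a::comm_ring_1 \<Rightarrow> nat \<Rightarrow> 'a" where
  "qfact q n = (\<Prod>i=1..n. 1 - q ^ i)"

lemma qfact_Suc: "qfact q (Suc n) = qfact q n * (1 - q ^ Suc n)"
  by (simp add: qfact_def)

text \<open>The quotient formula, cleared of denominators. The two terms of the recursion contribute
  \<open>1 - q^(l+1)\<close> and \<open>q^(l+1) (1 - q^m)\<close>, which add up to
  \<open>1 - q^(m+l+1)\<close>.\<close>

lemma qbinomial_mult_qfact:
  "qbinomial q (m + k) k * (qfact q k * qfact q m) = qfact q (m + k)"
proof (induction "m + k" arbitrary: m k)
  case (Suc n)
  show ?case
  proof (cases k)
    case k: (Suc l)
    have n: "n = m + l" using Suc k by simp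
    have 1: "qbinomial q n l * (qfact q l * qfact q m) = qfact q n"
      using Suc(1)[of m l] n by simp
    \<comment> \<open>At \<open>m = 0\<close> both sides vanish: the coefficient because
      \<open>n < Suc l\<close>, the right side because of \<open>1 - q ^ 0\<close>.\<close>
    have 2: "qbinomial q n (Suc l) * (qfact q (Suc l) * qfact q m) = qfact q n * (1 - q ^ m)"
    proof (cases m)
      case 0
      then show ?thesis using n by (simp add: qbinomial_eq_0)
    next
      case (Suc j)
      then have "qbinomial q n (Suc l) * (qfact q (Suc l) * qfact q j) = qfact q n"
        using Suc.hyps(1)[of j "Suc l"] n by simp
      then show ?thesis unfolding Suc qfact_Suc[of q j] by (metis mult.assoc)
    qed
    have "qbinomial q (m + k) k * (qfact q k * qfact q m)
        = (qbinomial q n l * (qfact q l * qfact q m)) * (1 - q ^ Suc l)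
          + q ^ Suc l * (qbinomial q n (Suc l) * (qfact q (Suc l) * qfact q m))"
      by (simp add: k n qfact_Suc algebra_simps)
    also have "\<dots> = qfact q n * (1 - q ^ Suc n)"
      unfolding 1 2 by (simp add: n algebra_simps power_add)
    finally show ?thesis by (simp add: k n qfact_Suc)
  qed (simp add: qfact_def)
qed (simp add: qfact_def)

section \<open>Theta exponents and the triple product\<close>

text \<open>\<open>theta_exp1\<close> and \<open>theta_exp2\<close> are the values of
  \<open>r n (n+1) / 2 - s n\<close> at \<open>n = j\<close> and \<open>n = -j-1\<close>, that is,
  the two halves of the bilateral theta series. The natural-number subtraction is exact for
  \<open>s \<le> r\<close>.\<close>

definition theta_exp1 :: "nat \<Rightarrow> nat \<Rightarrow> nat \<Rightarrow> nat" where
  "theta_exp1 r s j = r * (Suc j choose 2) - s * j"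

definition theta_exp2 :: "nat \<Rightarrow> nat \<Rightarrow> nat \<Rightarrow> nat" where
  "theta_exp2 r s j = r * (Suc j choose 2) + s * Suc j"

lemma Suc_choose_two_ge: "j \<le> Suc j choose 2"
  by (simp add: choose_two_Suc)

lemma theta_exp1_add: "s \<le> r \<Longrightarrow> theta_exp1 r s j + s * j = r * (Suc j choose 2)"
  unfolding theta_exp1_def
  by (intro le_add_diff_inverse2 mult_le_mono Suc_choose_two_ge)

lemma theta_exp1_ge: "s < r \<Longrightarrow> j \<le> theta_exp1 r s j"
proof -
  assume "s < r"
  then have "j + s * j \<le> r * (Suc j choose 2)"
    using mult_le_mono[of "Suc s" r, OF _ Suc_choose_two_ge[of j]] by simp
  then show ?thesis by (simp add: theta_exp1_def)
qed

lemma theta_exp2_ge: "0 < s \<Longrightarrow> Suc j \<le> theta_exp2 r s j"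
  by (cases s) (auto simp: theta_exp2_def)

lemma theta_exp2_eq: "s \<le> r \<Longrightarrow> theta_exp2 r s j = theta_exp1 r s j + (2 * j + 1) * s"
  using theta_exp1_add[of s r j] by (simp add: theta_exp2_def algebra_simps)

text \<open>The q-binomial theorem with \<open>2 * m\<close> factors, \<open>a = Q ^ m\<close> and
  \<open>b = - X^s\<close>. Factors with index at least \<open>m\<close> yield the first product,
  the others the second; a common signed monomial cancels at the end.\<close>

lemma finite_jacobi_triple_product:
  assumes "0 < s" "s < r"
  defines "Q \<equiv> fps_X ^ r :: 'a::idom fps"
  shows "(\<Prod>i<m. 1 - fps_X ^ (s + r * i)) * (\<Prod>i<m. 1 - fps_X ^ (r - s + r * i))
    = (\<Sum>j\<le>m. (-1) ^ j * qbinomial Q (2 * m) (m - j) * fps_X ^ theta_exp1 r s j)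
    - (\<Sum>j<m. (-1) ^ j * qbinomial Q (2 * m) (m + Suc j) * fps_X ^ theta_exp2 r s j)"
    (is "?A * ?B = ?R1 - ?R2")
proof -
  let ?X = "fps_X :: 'a fps"
  \<comment> \<open>The upper \<open>m\<close> factors each release \<open>X^(r m)\<close>, which
    gives \<open>r m^2\<close>; the lower ones release \<open>- X^(s + r i)\<close> for
    \<open>i < m\<close>, which gives the rest.\<close>
  define e where "e = r * m\<^sup>2 + s * m + r * (m choose 2)"
  have "(\<Prod>i<2 * m. Q ^ m + (- (?X ^ s)) * Q ^ i)
      = (\<Prod>i<m. Q ^ m - ?X ^ s * Q ^ i) * (\<Prod>i<m. Q ^ m - ?X ^ s * Q ^ (m + i))"
    by (simp add: mult_2 prod.nat_group lessThan_atLeast0 prod.atLeastLessThan_concat[of 0 m "m + m", symmetric]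
        prod.shift_bounds_nat_ivl[of _ 0 m m, simplified] add.commute)
  also have "(\<Prod>i<m. Q ^ m - ?X ^ s * Q ^ (m + i)) = (\<Prod>i<m. ?X ^ (r * m) * (1 - ?X ^ (s + r * i)))"
    by (intro prod.cong) (simp_all add: Q_def algebra_simps flip: power_mult power_add)
  also have "\<dots> = ?X ^ (r * m\<^sup>2) * ?A"
    by (simp add: prod.distrib power_mult power2_eq_square)
  also have "(\<Prod>i<m. Q ^ m - ?X ^ s * Q ^ i) = (\<Prod>i<m. Q ^ m - ?X ^ s * Q ^ (m - Suc i))"
    by (rule prod.nat_diff_reindex[symmetric])
  also have "\<dots> = (\<Prod>i<m. - (?X ^ (s + r * (m - Suc i))) * (1 - ?X ^ (r - s + r * i)))"
  proof (intro prod.cong refl)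
    fix i assume "i \<in> {..<m}"
    then have "m = Suc i + (m - Suc i)" by simp
    then have "r * m = r * Suc i + r * (m - Suc i)" by (metis distrib_left)
    then have "s + r * (m - Suc i) + (r - s + r * i) = r * m"
      using assms by simp
    then have "?X ^ (s + r * (m - Suc i)) * ?X ^ (r - s + r * i) = Q ^ m"
      by (simp only: power_add[symmetric] power_mult[symmetric] Q_def)
    then show "Q ^ m - ?X ^ s * Q ^ (m - Suc i) = - (?X ^ (s + r * (m - Suc i))) * (1 - ?X ^ (r - s + r * i))"
      by (simp add: right_diff_distrib) (simp add: power_add power_mult Q_def)
  qed
  also have "\<dots> = (\<Prod>i<m. - (?X ^ (s + r * i))) * ?B"
    by (simp only: prod.distrib prod.nat_diff_reindex[of "\<lambda>i. - (?X ^ (s + r * i))"])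
  also have "(\<Prod>i<m. - (?X ^ (s + r * i))) = (-1) ^ m * ?X ^ (s * m + r * (m choose 2))"
    by (induction m) (simp_all add: choose_two_Suc power_add algebra_simps binomial_eq_0)
  finally have lhs: "(\<Prod>i<2 * m. Q ^ m + (- (?X ^ s)) * Q ^ i) = (-1) ^ m * ?X ^ e * (?A * ?B)"
    by (simp add: e_def power_add mult_ac)
  let ?t = "\<lambda>k. qbinomial Q (2 * m) k * Q ^ (k choose 2) * (- (?X ^ s)) ^ k * (Q ^ m) ^ (2 * m - k)"
  have t: "?t k = (-1) ^ k * qbinomial Q (2 * m) k * ?X ^ (r * (k choose 2) + s * k + r * m * (2 * m - k))" for k
    unfolding Q_def power_minus[of "?X ^ s"] by (simp add: power_add mult.assoc mult_ac flip: power_mult)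
  \<comment> \<open>Split around the middle: \<open>k = m - j\<close> produces the exponents
    \<open>theta_exp1\<close>, and \<open>k = m + Suc j\<close> the exponents
    \<open>theta_exp2\<close>.\<close>
  have "(\<Sum>k\<le>2 * m. ?t k) = (\<Sum>k\<le>m. ?t k) + (\<Sum>k\<in>{m<..2 * m}. ?t k)"
    by (subst sum.union_disjoint[symmetric]) (auto intro!: sum.cong)
  also have "(\<Sum>k\<le>m. ?t k) = (\<Sum>j\<le>m. ?t (m - j))"
    by (rule sum.reindex_bij_witness[of _ "\<lambda>j. m - j" "\<lambda>j. m - j"]) auto
  also have "\<dots> = (-1) ^ m * ?X ^ e * ?R1"
    unfolding sum_distrib_left
  proof (intro sum.cong refl)
    fix j assume "j \<in> {..m}"
    then obtain d where m: "m = d + j" by (auto simp: le_iff_add add.commute)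
    have E: "r * ((m - j) choose 2) + s * (m - j) + r * m * (2 * m - (m - j)) = e + theta_exp1 r s j"
    proof -
      have "((m - j) choose 2) + m * (2 * m - (m - j)) = m\<^sup>2 + (m choose 2) + (Suc j choose 2)"
        using choose_two_square[of j]
        by (simp add: m choose_two_Suc choose_two_add power2_eq_square algebra_simps)
      from arg_cong[OF this, of "(*) r"]
      have "r * ((m - j) choose 2) + r * m * (2 * m - (m - j)) = r * m\<^sup>2 + r * (m choose 2) + r * (Suc j choose 2)"
        by (simp only: distrib_left mult.assoc)
      moreover have "s * (m - j) + s * j = s * m"
        by (simp add: m distrib_left)
      ultimately show ?thesis
        using theta_exp1_add[of s r j] assms(2) by (simp add: e_def)
    qed
    have sgn: "(-1) ^ (m - j) = (-1) ^ m * ((-1) ^ j :: 'a fps)"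
      by (simp add: m power_add mult.assoc)
    show "?t (m - j) = (-1) ^ m * ?X ^ e * ((-1) ^ j * qbinomial Q (2 * m) (m - j) * ?X ^ theta_exp1 r s j)"
      unfolding t unfolding E sgn power_add by (simp only: mult_ac)
  qed
  also have "(\<Sum>k\<in>{m<..2 * m}. ?t k) = (\<Sum>j<m. ?t (m + Suc j))"
    by (rule sum.reindex_bij_witness[of _ "\<lambda>j. m + Suc j" "\<lambda>k. k - Suc m"]) auto
  also have "\<dots> = (-1) ^ m * ?X ^ e * (- ?R2)"
    unfolding sum_distrib_left sum_negf[symmetric]
  proof (intro sum.cong refl)
    fix j assume "j \<in> {..<m}"
    then obtain d where m: "m = d + Suc j" by (auto simp: less_iff_Suc_add add.commute)
    have E: "r * ((m + Suc j) choose 2) + s * (m + Suc j) + r * m * (2 * m - (m + Suc j)) = e + theta_exp2 r s j"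
    proof -
      have "((m + Suc j) choose 2) + m * (2 * m - (m + Suc j)) = m\<^sup>2 + (m choose 2) + (Suc j choose 2)"
        using choose_two_square[of j]
        by (simp add: m choose_two_Suc choose_two_add power2_eq_square algebra_simps)
      from arg_cong[OF this, of "(*) r"]
      have "r * ((m + Suc j) choose 2) + r * m * (2 * m - (m + Suc j)) = r * m\<^sup>2 + r * (m choose 2) + r * (Suc j choose 2)"
        by (simp only: distrib_left mult.assoc)
      moreover have "s * (m + Suc j) = s * m + s * Suc j"
        by (rule distrib_left)
      ultimately show ?thesis
        by (simp add: e_def theta_exp2_def)
    qed
    show "?t (m + Suc j) = (-1) ^ m * ?X ^ e * - ((-1) ^ j * qbinomial Q (2 * m) (m + Suc j) * ?X ^ theta_exp2 r s j)"
      unfolding t unfolding E power_add by simp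
  qed
  finally have "(-1) ^ m * ?X ^ e * (?A * ?B) = (-1) ^ m * ?X ^ e * (?R1 - ?R2)"
    unfolding lhs[symmetric] qbinomial_theorem by (simp only: distrib_left diff_conv_add_uminus)
  then show ?thesis by simp
qed

lemma qfact_nth_0: "q $ 0 = 0 \<Longrightarrow> qfact (q :: 'a::comm_ring_1 fps) n $ 0 = 1"
  by (induction n) (simp_all add: qfact_def)

text \<open>The coefficient is \<open>(q)_2m / ((q)_(m-j) (q)_(m+j))\<close>; multiplying by
  \<open>(q)_m\<close> leaves only factors whose index exceeds \<open>m - j\<close>.\<close>

lemma qbinomial_mult_qfact_X_power:
  assumes "0 < r" "j \<le> m" "k = m - j \<or> k = m + j"
  shows "qfact (fps_X ^ r) m * qbinomial (fps_X ^ r) (2 * m) k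
     = (\<Prod>i\<in>{m - j<..m}. 1 - fps_X ^ (r * i)) * (\<Prod>i\<in>{m + j<..2 * m}. 1 - (fps_X :: 'a::idom fps) ^ (r * i))"
proof -
  let ?q = "fps_X ^ r :: 'a fps"
  have split: "qfact ?q b = qfact ?q a * (\<Prod>i\<in>{a<..b}. 1 - fps_X ^ (r * i))" if "a \<le> b" for a b
  proof -
    have "{1..b} = {1..a} \<union> {a<..b}" using that by auto
    then show ?thesis
      unfolding qfact_def power_mult by (simp only:) (intro prod.union_disjoint, auto)
  qed
  have nz: "qfact ?q a \<noteq> 0" for a
    using qfact_nth_0[of ?q a] assms(1) by auto
  have bin: "qbinomial ?q (2 * m) k * (qfact ?q (m - j) * qfact ?q (m + j)) = qfact ?q (2 * m)"
    using assms(3)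
  proof
    assume "k = m - j"
    then show ?thesis
      using qbinomial_mult_qfact[of ?q "m + j" "m - j"] assms(2) by (simp add: mult_2)
  next
    assume "k = m + j"
    then show ?thesis
      using qbinomial_mult_qfact[of ?q "m - j" "m + j"] assms(2) by (simp add: mult_2 mult_2_right mult_ac)
  qed
  have "qfact ?q m * qbinomial ?q (2 * m) k * qfact ?q (m + j)
     = (qbinomial ?q (2 * m) k * (qfact ?q (m - j) * qfact ?q (m + j))) * (\<Prod>i\<in>{m - j<..m}. 1 - fps_X ^ (r * i))"
    by (subst split[of "m - j" m]) (simp_all add: mult_ac)
  also have "\<dots> = ((\<Prod>i\<in>{m - j<..m}. 1 - fps_X ^ (r * i)) * (\<Prod>i\<in>{m + j<..2 * m}. 1 - fps_X ^ (r * i))) * qfact ?q (m + j)"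
    unfolding bin using assms(2) by (subst split[of "m + j" "2 * m"]) (simp_all add: mult_ac)
  finally show ?thesis
    using nz by simp
qed

text \<open>Thus, for fixed \<open>j\<close>, \<open>(q)_m\<close> times the Gaussian coefficient
  tends to 1 as \<open>m\<close> grows, which turns the finite identity into the infinite
  one.\<close>

lemma qbinomial_mult_qfact_X_power_nth:
  assumes "0 < r" "j \<le> m" "k = m - j \<or> k = m + j" "n \<le> m - j"
  shows "(qfact (fps_X ^ r) m * qbinomial (fps_X ^ r) (2 * m) k :: 'a::idom fps) $ n = of_bool (n = 0)"
proof -
  have le: "i \<le> r * i" for i using assms(1) by simp
  have "(1 * (\<Prod>i\<in>{m - j<..m}. 1 - fps_X ^ (r * i)) * (\<Prod>i\<in>{m + j<..2 * m}. 1 - (fps_X :: 'a fps) ^ (r * i))) $ n = 1 $ n"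
    using assms(4) order.strict_trans2[OF _ le]
    by (subst fps_nth_prod_one_minus_X_power, simp, force)+ simp
  then show ?thesis
    unfolding qbinomial_mult_qfact_X_power[OF assms(1-3)] by simp
qed

text \<open>The formal counterpart of \<open>truncated_theta\<close>. Stopping at
  \<open>j = n\<close> loses nothing for \<open>0 < s\<close> and \<open>s < r\<close>, since both
  exponents are then at least \<open>j\<close>.\<close>

definition theta_fps :: "nat \<Rightarrow> nat \<Rightarrow> nat \<Rightarrow> 'a::comm_ring_1 fps" where
  "theta_fps r s k = Abs_fps (\<lambda>n. \<Sum>j\<in>{k..n}. (-1) ^ j * (of_bool (n = theta_exp1 r s j) - of_bool (n = theta_exp2 r s j)))"

lemma theta_fps_nth:
  assumes "0 < s" "s < r" "n < N"
  shows "(\<Sum>j\<in>{k..<N}. (-1) ^ j * (fps_X ^ theta_exp1 r s j - fps_X ^ theta_exp2 r s j)) $ n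
     = (theta_fps r s k :: 'a::comm_ring_1 fps) $ n"
proof -
  have sgn: "((-1) ^ j * f) $ n = (-1) ^ j * f $ n" for j and f :: "'a fps"
    by (cases "even j") auto
  have ne: "(fps_X ^ theta_exp1 r s j - fps_X ^ theta_exp2 r s j :: 'a fps) $ n = 0" if "n < j" for j
    using that theta_exp1_ge[OF assms(2), of j] theta_exp2_ge[OF assms(1), of j r] by simp
  show ?thesis
    unfolding theta_fps_def fps_sum_nth sgn fps_nth_Abs_fps
    using assms(3) by (intro sum.mono_neutral_cong_right ballI) (auto simp: ne not_le simp del: fps_sub_nth, auto)
qed

text \<open>The finite identity is multiplied by \<open>(q)_m\<close>; coefficient \<open>n\<close>
  of the result is already final for all \<open>m > n\<close>.\<close>

theorem jacobi_triple_product_fps: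
  assumes "0 < s" "s < r"
  shows "euler_fps (\<lambda>i. s + r * i) * euler_fps (\<lambda>i. r - s + r * i) * euler_fps (\<lambda>i. r * Suc i)
     = (theta_fps r s 0 :: 'a::idom fps)"
proof (rule LIMSEQ_unique)
  let ?A = "\<lambda>m. \<Prod>i<m. 1 - fps_X ^ (s + r * i) :: 'a fps"
  let ?B = "\<lambda>m. \<Prod>i<m. 1 - fps_X ^ (r - s + r * i) :: 'a fps"
  let ?C = "\<lambda>m. \<Prod>i<m. 1 - fps_X ^ (r * Suc i) :: 'a fps"
  have lt: "i < r * Suc i" "i < s + r * i" "i < r - s + r * i" for i
  proof -
    have "i \<le> r * i" using assms by simp
    then show "i < r * Suc i" "i < s + r * i" "i < r - s + r * i"
      using assms unfolding mult_Suc_right by linarith+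
  qed
  show "(\<lambda>m. ?A m * ?B m * ?C m) \<longlonglongrightarrow> euler_fps (\<lambda>i. s + r * i) * euler_fps (\<lambda>i. r - s + r * i) * euler_fps (\<lambda>i. r * Suc i)"
    by (intro tendsto_mult_fps tendsto_euler_fps lt)
  show "(\<lambda>m. ?A m * ?B m * ?C m) \<longlonglongrightarrow> theta_fps r s 0"
  proof (rule tendsto_fpsI, rule eventually_mono[OF eventually_gt_at_top])
    fix n m :: nat assume nm: "n < m"
    let ?W = "\<lambda>k. qfact (fps_X ^ r) m * qbinomial (fps_X ^ r) (2 * m) k :: 'a fps"
    have C: "?C m = qfact (fps_X ^ r) m"
      unfolding qfact_def power_mult by (rule prod.reindex_bij_witness[of _ "\<lambda>i. i - 1" Suc]) auto
    have "?A m * ?B m * ?C m = (\<Sum>j\<le>m. (-1) ^ j * (?W (m - j) * fps_X ^ theta_exp1 r s j))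
      - (\<Sum>j<m. (-1) ^ j * (?W (m + Suc j) * fps_X ^ theta_exp2 r s j))"
      unfolding C finite_jacobi_triple_product[OF assms] left_diff_distrib sum_distrib_right
      by (simp add: mult_ac)
    moreover have sgn: "((-1) ^ j * f) $ n = (-1) ^ j * f $ n" for j and f :: "'a fps"
      by (cases "even j") auto
    moreover have "(?W (m - j) * fps_X ^ theta_exp1 r s j) $ n = of_bool (n = theta_exp1 r s j)" if "j \<le> m" for j
    proof -
      \<comment> \<open>From \<open>n < m\<close> and \<open>j \<le> theta_exp1 r s j\<close> the
        index is at most \<open>m - j\<close>, where the coefficients of \<open>?W (m - j)\<close>
        are those of 1.\<close>
      have "?W (m - j) $ (n - theta_exp1 r s j) = of_bool (n - theta_exp1 r s j = 0)"
        using that nm theta_exp1_ge[OF assms(2), of j] assms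
        by (intro qbinomial_mult_qfact_X_power_nth) auto
      then show ?thesis
        unfolding fps_X_power_mult_right_nth by auto
    qed
    moreover have "(?W (m + Suc j) * fps_X ^ theta_exp2 r s j) $ n = of_bool (n = theta_exp2 r s j)" if "j < m" for j
    proof -
      have "?W (m + Suc j) $ (n - theta_exp2 r s j) = of_bool (n - theta_exp2 r s j = 0)"
        using that nm theta_exp2_ge[OF assms(1), of j r] assms
        by (intro qbinomial_mult_qfact_X_power_nth[where j = "Suc j"]) auto
      then show ?thesis
        unfolding fps_X_power_mult_right_nth by auto
    qed
    ultimately have "(?A m * ?B m * ?C m) $ n = (\<Sum>j\<le>m. (-1) ^ j * of_bool (n = theta_exp1 r s j))
      - (\<Sum>j<m. (-1) ^ j * of_bool (n = theta_exp2 r s j))"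
      by (simp add: fps_sum_nth)
    \<comment> \<open>The extra term \<open>j = m\<close> has exponent at least
      \<open>m > n\<close>.\<close>
    also have "(\<Sum>j\<le>m. (-1) ^ j * of_bool (n = theta_exp1 r s j)) = (\<Sum>j<m. (-1) ^ j * of_bool (n = theta_exp1 r s j) :: 'a)"
      using nm theta_exp1_ge[OF assms(2), of m] by (simp add: lessThan_Suc_atMost[symmetric])
    also have "\<dots> - (\<Sum>j<m. (-1) ^ j * of_bool (n = theta_exp2 r s j))
      = (\<Sum>j\<in>{0..<m}. (-1) ^ j * (fps_X ^ theta_exp1 r s j - fps_X ^ theta_exp2 r s j)) $ n"
      by (simp add: fps_sum_nth sgn lessThan_atLeast0 sum_subtractf[symmetric] right_diff_distrib of_bool_def)
    finally show "(?A m * ?B m * ?C m) $ n = (theta_fps r s 0 :: 'a fps) $ n"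
      unfolding theta_fps_nth[OF assms nm] .
  qed
qed

section \<open>Bounded coefficients and the pentagonal number theorem\<close>

lemma theta_exp1_strict_mono: "s < r \<Longrightarrow> strict_mono (theta_exp1 r s)"
proof (rule strict_monoI_Suc)
  fix j assume "s < r"
  have "r * (Suc (Suc j) choose 2) = r * (Suc j choose 2) + r * Suc j"
    by (simp only: choose_two_Suc[of "Suc j"] distrib_left)
  moreover have "s * Suc j < r * Suc j" using \<open>s < r\<close> by (intro mult_strict_right_mono) simp_all
  moreover have "s * Suc j = s * j + s" by simp
  ultimately show "theta_exp1 r s j < theta_exp1 r s (Suc j)"
    using theta_exp1_add[of s r j] theta_exp1_add[of s r "Suc j"] \<open>s < r\<close> by linarith
qed

lemma theta_exp2_strict_mono: "0 < s \<Longrightarrow> strict_mono (theta_exp2 r s)"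
  by (rule strict_monoI_Suc) (simp add: theta_exp2_def choose_two_Suc distrib_left)

lemma sum_of_bool_inj_le:
  assumes "inj f" "finite A"
  shows "(\<Sum>j\<in>A. of_bool (n = f j) :: real) \<le> 1"
proof -
  have "card {j \<in> A. n = f j} \<le> Suc 0"
    using assms by (subst card_le_Suc0_iff_eq) (auto simp: inj_def)
  then show ?thesis
    using assms(2) by (simp add: of_bool_def sum.If_cases Int_def)
qed

text \<open>Both exponent sequences increase strictly, so each meets \<open>n\<close> at most
  once.\<close>

lemma theta_fps_nth_abs_le:
  assumes "0 < s" "s < r"
  shows "\<bar>(theta_fps r s k :: real fps) $ n\<bar> \<le> 2"
proof -
  have "\<bar>(theta_fps r s k :: real fps) $ n\<bar>
      \<le> (\<Sum>j\<in>{k..n}. of_bool (n = theta_exp1 r s j) + of_bool (n = theta_exp2 r s j))"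
    unfolding theta_fps_def fps_nth_Abs_fps
    by (intro order.trans[OF sum_abs] sum_mono) (simp add: abs_mult)
  also have "\<dots> \<le> 1 + 1"
    unfolding sum.distrib using assms
    by (intro add_mono sum_of_bool_inj_le strict_mono_imp_inj_on theta_exp1_strict_mono theta_exp2_strict_mono) auto
  finally show ?thesis by simp
qed

text \<open>The pentagonal number theorem in \<open>X^r\<close>: the multiples of \<open>r\<close>
  fall into the classes \<open>r\<close>, \<open>2 r\<close> and \<open>0\<close> modulo
  \<open>3 r\<close>, which are the three products for \<open>(3 r, r)\<close>.\<close>

lemma euler_fps_eq_theta:
  assumes "0 < r"
  shows "euler_fps (\<lambda>i. r * Suc i) = (theta_fps (3 * r) r 0 :: 'a::idom fps)"
proof -
  let ?P = "\<lambda>f N. \<Prod>i<N. 1 - fps_X ^ f i :: 'a fps"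
  have lt: "i < r * Suc i" "i < r + 3 * r * i" "i < 3 * r - r + 3 * r * i" "i < 3 * r * Suc i" for i
  proof -
    have "i \<le> r * i" using assms by simp
    then show "i < r * Suc i" "i < r + 3 * r * i" "i < 3 * r - r + 3 * r * i" "i < 3 * r * Suc i"
      using assms unfolding mult_Suc_right mult.assoc by linarith+
  qed
  have "?P (\<lambda>i. r * Suc i) (3 * N)
     = ?P (\<lambda>i. r + 3 * r * i) N * ?P (\<lambda>i. 3 * r - r + 3 * r * i) N * ?P (\<lambda>i. 3 * r * Suc i) N" for N
  proof (induction N)
    case (Suc N)
    have e: "r * Suc (3 * N) = r + 3 * r * N" "r * Suc (Suc (3 * N)) = 3 * r - r + 3 * r * N"
      "r * Suc (Suc (Suc (3 * N))) = 3 * r * Suc N" "3 * Suc N = Suc (Suc (Suc (3 * N)))"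
      by simp_all
    have alg: "a * b * c * d1 * d2 * d3 = (a * d1) * (b * d2) * (c * d3)" for a b c d1 d2 d3 :: "'a fps"
      by (simp only: mult_ac)
    show ?case
      by (simp only: e prod.lessThan_Suc Suc.IH alg)
  qed simp
  \<comment> \<open>Only partial products with \<open>3 * N\<close> factors split evenly, so the
    limit is taken along this subsequence.\<close>
  moreover have "(\<lambda>N. ?P (\<lambda>i. r * Suc i) (3 * N)) \<longlonglongrightarrow> euler_fps (\<lambda>i. r * Suc i)"
    by (rule filterlim_compose[OF tendsto_euler_fps[OF lt(1)]]) (rule mult_nat_left_at_top, simp)
  ultimately have "(\<lambda>N. ?P (\<lambda>i. r + 3 * r * i) N * ?P (\<lambda>i. 3 * r - r + 3 * r * i) N * ?P (\<lambda>i. 3 * r * Suc i) N)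
     \<longlonglongrightarrow> euler_fps (\<lambda>i. r * Suc i)"
    by (simp only:)
  moreover have "(\<lambda>N. ?P (\<lambda>i. r + 3 * r * i) N * ?P (\<lambda>i. 3 * r - r + 3 * r * i) N * ?P (\<lambda>i. 3 * r * Suc i) N)
     \<longlonglongrightarrow> euler_fps (\<lambda>i. r + 3 * r * i) * euler_fps (\<lambda>i. 3 * r - r + 3 * r * i) * euler_fps (\<lambda>i. 3 * r * Suc i)"
    by (intro tendsto_mult_fps tendsto_euler_fps lt)
  ultimately have "euler_fps (\<lambda>i. r * Suc i)
     = euler_fps (\<lambda>i. r + 3 * r * i) * euler_fps (\<lambda>i. 3 * r - r + 3 * r * i) * (euler_fps (\<lambda>i. 3 * r * Suc i) :: 'a fps)"
    by (rule LIMSEQ_unique)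
  also have "\<dots> = theta_fps (3 * r) r 0"
    using assms by (intro jacobi_triple_product_fps) auto
  finally show ?thesis .
qed

subsection \<open>Growth of partition functions\<close>

definition two_parts :: "nat \<Rightarrow> nat \<Rightarrow> real fps" where
  "two_parts x y = inverse (1 - fps_X ^ x) * inverse (1 - fps_X ^ y)"

lemma two_parts_nth:
  assumes "0 < x" "0 < y"
  shows "two_parts x y $ n = real (card {i. i \<le> n \<and> x dvd i \<and> y dvd n - i})"
proof -
  have "two_parts x y $ n = (\<Sum>i\<in>{0..n}. of_bool (x dvd i \<and> y dvd n - i))"
    by (simp add: two_parts_def fps_mult_nth inverse_one_minus_X_power_nth assms of_bool_conj)
  also have "\<dots> = real (card {i \<in> {0..n}. x dvd i \<and> y dvd n - i})"
    by (simp add: of_bool_def sum.If_cases Int_def)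
  finally show ?thesis by simp
qed

text \<open>With \<open>u\<close> inverse to \<open>x\<close> modulo \<open>y\<close>,
  \<open>v = u n mod y\<close> solves \<open>x v = n\<close> modulo \<open>y\<close>. Adding
  multiples of \<open>x y\<close> to \<open>x v\<close> gives further representations, about one for
  each period up to \<open>n\<close>.\<close>

lemma two_parts_nth_ge:
  assumes "0 < x" "0 < y" "coprime x y"
  shows "real n / real (x * y) - 1 \<le> two_parts x y $ n"
proof -
  obtain u w where u: "x * u = y * w + 1"
    using bezout_nat[of x y] assms by auto
  define v where "v = (u * n) mod y"
  have "x * v mod y = (x * u) * n mod y"
    by (simp add: v_def mod_mult_right_eq mult.assoc)
  also have "\<dots> = n mod y"
    unfolding u by (simp add: distrib_right mult.assoc)
  finally have v: "x * v mod y = n mod y" "v < y"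
    using assms(2) by (auto simp: v_def)
  let ?f = "\<lambda>t. x * v + t * (x * y)"
  have "?f ` {..<n div (x * y)} \<subseteq> {i. i \<le> n \<and> x dvd i \<and> y dvd n - i}"
  proof safe
    fix t assume "t < n div (x * y)"
    then have "Suc t * (x * y) \<le> n"
      using assms by (metis Suc_leI div_times_less_eq_dividend le_trans mult_le_mono1)
    moreover have "x * v \<le> x * y" using v(2) by simp
    ultimately show le: "?f t \<le> n" unfolding mult_Suc by linarith
    have "?f t mod y = n mod y"
      using v(1) by (simp add: mult.assoc[symmetric])
    then show "y dvd n - ?f t"
      using mod_eq_dvd_iff_nat[OF le, of y] by simp
  qed (simp)
  moreover have "inj_on ?f {..<n div (x * y)}"
    using assms by (auto simp: inj_on_def)
  ultimately have "card {..<n div (x * y)} \<le> card {i. i \<le> n \<and> x dvd i \<and> y dvd n - i}"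
    by (intro card_inj_on_le) auto
  moreover have "real n / real (x * y) - 1 \<le> real (n div (x * y))"
    using floor_divide_of_nat_eq[of n "x * y", where ?'a = real] by linarith
  ultimately show ?thesis
    unfolding two_parts_nth[OF assms(1,2)] card_lessThan by linarith
qed

text \<open>If \<open>u x = v y + 1\<close> then \<open>1 - X = (1 - X\<^sup>u\<^sup>x) - X (1 - X\<^sup>v\<^sup>y)\<close>, and each summand
  cancels one of the two factors of the denominator.\<close>
lemma two_parts_diff_bounded:
  assumes "0 < x" "0 < y" "coprime x y"
  shows "\<exists>K. \<forall>n. \<bar>((1 - fps_X) * two_parts x y) $ n\<bar> \<le> K"
proof -
  obtain u v where uv: "x * u = y * v + 1"
    using bezout_nat[of x y] assms by auto
  define I where "I d = inverse (1 - fps_X ^ d :: real fps)" for d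
  have inv: "(1 - fps_X ^ d) * I d = 1" if "0 < d" for d
    unfolding I_def using that by (intro inverse_mult_eq_1') simp
  have geo: "(1 - fps_X ^ (d * w)) * I d = (\<Sum>i<w. fps_X ^ (d * i))" if "0 < d" for d w
  proof -
    have "(1 - fps_X ^ (d * w)) * I d = ((1 - fps_X ^ d) * I d) * (\<Sum>i<w. fps_X ^ (d * i))"
      unfolding power_mult one_diff_power_eq[of "fps_X ^ d"] by (simp only: mult_ac)
    then show ?thesis by (simp add: inv that)
  qed
  have 1: "(1 - fps_X :: real fps) = (1 - fps_X ^ (x * u)) - fps_X * (1 - fps_X ^ (y * v))"
  proof -
    have "fps_X ^ (x * u) = fps_X * (fps_X ^ (y * v) :: real fps)"
      unfolding uv power_add power_one_right by (rule mult.commute)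
    moreover have "1 - a = (1 - a * b) - a * (1 - b)" for a b :: "real fps"
      by (simp add: algebra_simps)
    ultimately show ?thesis by (simp only:)
  qed
  have "(1 - fps_X) * two_parts x y = (1 - fps_X ^ (x * u)) * I x * I y - fps_X * ((1 - fps_X ^ (y * v)) * I y) * I x"
  proof -
    have "(p - z * q) * (a * b) = p * a * b - z * (q * b) * a" for p q z a b :: "real fps"
      by (simp add: algebra_simps)
    then show ?thesis
      unfolding two_parts_def I_def[symmetric] 1 by this
  qed
  \<comment> \<open>Both quotients are finite geometric sums, so \<open>u + v\<close> shifted
    geometric series remain, all with coefficients 0 or 1.\<close>
  also have "\<dots> = (\<Sum>i<u. fps_X ^ (x * i) * I y) - (\<Sum>i<v. fps_X ^ Suc (y * i) * I x)"
    unfolding geo[OF assms(1)] geo[OF assms(2)] sum_distrib_right sum_distrib_left power_Suc by (rule refl)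
  finally have eq: "(1 - fps_X) * two_parts x y = \<dots>" .
  have le: "\<bar>(fps_X ^ e * I d) $ n\<bar> \<le> 1" if "0 < d" for e d n
    unfolding I_def fps_X_power_mult_nth inverse_one_minus_X_power_nth[OF that] by auto
  have "\<bar>((1 - fps_X) * two_parts x y) $ n\<bar> \<le> real u + real v" for n
  proof -
    have "\<bar>((1 - fps_X) * two_parts x y) $ n\<bar>
      \<le> \<bar>\<Sum>i<u. (fps_X ^ (x * i) * I y) $ n\<bar> + \<bar>\<Sum>i<v. (fps_X ^ Suc (y * i) * I x) $ n\<bar>"
      unfolding eq fps_sub_nth fps_sum_nth by (rule abs_triangle_ineq4)
    also have "\<dots> \<le> (\<Sum>i<u. 1) + (\<Sum>i<v. 1)"
      by (intro add_mono order.trans[OF sum_abs] sum_mono le assms)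
    finally show ?thesis by simp
  qed
  then show ?thesis by blast
qed

text \<open>
  In the application \<open>C\<close> is the generating function of partitions into some set of parts, \<open>S\<close> is its
  logarithmic derivative \<open>X C' / C\<close>, and \<open>B\<close> accounts for two further coprime parts.
\<close>
locale partition_growth =
  fixes B C S :: "real fps" and L :: real
  assumes C0: "C $ 0 = 1"
    and S_nonneg: "\<And>m. 0 \<le> S $ m"
    and log_deriv: "fps_X * fps_deriv C = C * S"
    and S_small: "(\<lambda>m. S $ m / (real m)\<^sup>2) \<longlonglongrightarrow> 0"
    and L_pos: "0 < L"
    and B_nonneg: "\<And>m. 0 \<le> B $ m"
    and B_ge: "\<And>m. real m / L - 1 \<le> B $ m"
begin

abbreviation "G \<equiv> B * C"

lemma S0: "S $ 0 = 0"
  using arg_cong[OF log_deriv, of "\<lambda>f. f $ 0"] C0 by simp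

text \<open>Coefficient \<open>n\<close> of \<open>X C' = C S\<close>; the term \<open>m = 0\<close>
  drops out because \<open>S $ 0 = 0\<close>. Nonnegativity and decay of \<open>C\<close> both rest
  on this recurrence.\<close>

lemma C_rec: "real n * C $ n = (\<Sum>m=1..n. S $ m * C $ (n - m))"
proof -
  have "real n * C $ n = (S * C) $ n"
  proof -
    have "real n * C $ n = (fps_X * fps_deriv C) $ n"
      by (cases n) simp_all
    then show ?thesis
      unfolding log_deriv mult.commute[of C S] .
  qed
  also have "\<dots> = (\<Sum>m=1..n. S $ m * C $ (n - m))"
    unfolding fps_mult_nth by (subst sum.atLeast_Suc_atMost) (simp_all add: S0)
  finally show ?thesis .
qed

lemma C_nonneg: "0 \<le> C $ n"
proof (induction n rule: less_induct)
  case (less n)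
  show ?case
  proof (cases "n = 0")
    case False
    have "0 \<le> real n * C $ n"
      unfolding C_rec by (intro sum_nonneg mult_nonneg_nonneg S_nonneg less.IH) (use False in auto)
    then show ?thesis using False by (simp add: zero_le_mult_iff)
  qed (simp add: C0)
qed

lemma G_nonneg: "0 \<le> G $ n"
  unfolding fps_mult_nth by (intro sum_nonneg mult_nonneg_nonneg B_nonneg C_nonneg)

lemma G_ge_term: "i \<le> n \<Longrightarrow> B $ i * C $ (n - i) \<le> G $ n"
  unfolding fps_mult_nth
  by (rule member_le_sum[of i "{0..n}" "\<lambda>i. B $ i * C $ (n - i)"]) (auto intro: mult_nonneg_nonneg B_nonneg C_nonneg)

text \<open>The convolution term with \<open>C $ 0 = 1\<close> alone contributes
  \<open>B $ n\<close>.\<close>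

lemma G_at_top: "filterlim (\<lambda>n. G $ n) at_top sequentially"
proof (rule filterlim_at_top_mono)
  show "filterlim (\<lambda>n. real n / L - 1) at_top sequentially"
    using L_pos by real_asymp
  show "\<forall>\<^sub>F n in sequentially. real n / L - 1 \<le> G $ n"
  proof (rule always_eventually, rule allI)
    fix n
    show "real n / L - 1 \<le> G $ n"
      using G_ge_term[of n n] B_ge[of n] by (simp add: C0)
  qed
qed

text \<open>
  In \<open>(n - i) c(n - i) = \<Sum> S(m) c(n - i - m)\<close> the terms with large \<open>m\<close> are controlled by
  \<open>S(m) / m = o(B(m + i))\<close>, and each of the finitely many others gains a factor \<open>1 / (n - i)\<close>.
\<close>
lemma C_shift_smallo_step:
  assumes "\<And>m. 1 \<le> m \<Longrightarrow> (\<lambda>n. C $ (n - (i + m))) \<in> O(\<lambda>n. G $ n)"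
  shows "(\<lambda>n. C $ (n - i)) \<in> o(\<lambda>n. G $ n)"
proof (rule landau_o.smallI)
  fix \<epsilon> :: real assume \<epsilon>: "0 < \<epsilon>"
  \<comment> \<open>One factor 2 leaves room for the finitely many small \<open>m\<close>; the other
    pays for \<open>m / (2 L) \<le> m / L - 1\<close>, valid once
    \<open>2 L \<le> m\<close>.\<close>
  have "\<forall>\<^sub>F m in sequentially. S $ m / (real m)\<^sup>2 < \<epsilon> / (4 * L)"
    using S_small \<epsilon> L_pos by (intro order_tendstoD(2)) auto
  moreover have "\<forall>\<^sub>F m in sequentially. 2 * L \<le> real m"
    using filterlim_real_sequentially by (simp add: filterlim_at_top)
  ultimately have "\<forall>\<^sub>F m in sequentially. S $ m \<le> real m * (\<epsilon> / 2 * B $ (m + i))"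
    using eventually_gt_at_top[of 0]
  proof eventually_elim
    case (elim m)
    have "S $ m \<le> \<epsilon> / (4 * L) * (real m)\<^sup>2"
      using elim by (simp add: divide_less_eq)
    also have "\<dots> = real m * (\<epsilon> / 2 * (real m / (2 * L)))"
      by (simp add: power2_eq_square)
    also have "real m / (2 * L) \<le> real m / L - 1"
      using elim L_pos by (simp add: field_simps)
    also have "\<dots> \<le> real (m + i) / L - 1"
      using L_pos by (simp add: divide_right_mono)
    also have "\<dots> \<le> B $ (m + i)"
      by (rule B_ge)
    finally show ?case
      using \<epsilon> by (simp add: mult_left_mono)
  qed
  then obtain M where M: "\<And>m. M \<le> m \<Longrightarrow> S $ m \<le> real m * (\<epsilon> / 2 * B $ (m + i))"
    by (auto simp: eventually_sequentially)
  define h where "h = (\<lambda>n. \<Sum>m\<in>{1..<M}. S $ m / real (n - i) * C $ (n - (i + m)))"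
  have "h \<in> o(\<lambda>n. G $ n)"
    unfolding h_def
  proof (rule big_sum_in_smallo)
    fix m assume "m \<in> {1..<M}"
    have "(\<lambda>n. S $ m / real (n - i)) \<in> o(\<lambda>n. 1)"
    proof (rule smalloI_tendsto)
      have "(\<lambda>n. S $ m / real n) \<longlonglongrightarrow> 0"
        by real_asymp
      then show "(\<lambda>n. S $ m / real (n - i) / 1) \<longlonglongrightarrow> 0"
        unfolding div_by_1 by (rule filterlim_compose) (rule filterlim_minus_const_nat_at_top)
    qed simp
    from landau_o.small_big_mult[OF this assms[of m]] \<open>m \<in> {1..<M}\<close>
    show "(\<lambda>n. S $ m / real (n - i) * C $ (n - (i + m))) \<in> o(\<lambda>n. G $ n)"
      by simp
  qed
  then have "\<forall>\<^sub>F n in sequentially. norm (h n) \<le> \<epsilon> / 2 * norm (G $ n)"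
    using \<epsilon> by (intro landau_o.smallD) auto
  then show "\<forall>\<^sub>F n in sequentially. norm (C $ (n - i)) \<le> \<epsilon> * norm (G $ n)"
    using eventually_gt_at_top[of "i + M"]
  proof eventually_elim
    case (elim n)
    let ?N = "real (n - i)"
    have N: "?N > 0" using elim by simp
    have "C $ (n - i) = (\<Sum>m=1..n-i. S $ m * C $ (n - i - m)) / ?N"
      using C_rec[of "n - i"] N by (simp add: field_simps)
    also have "\<dots> = (\<Sum>m\<in>{1..n-i}. S $ m / ?N * C $ (n - (i + m)))"
      by (simp add: sum_divide_distrib)
    \<comment> \<open>Only an inequality: for \<open>M = 0\<close> the right side also contains the
      nonnegative term \<open>m = 0\<close>.\<close>
    also have "\<dots> \<le> (\<Sum>m\<in>{1..<M} \<union> {M..n-i}. S $ m / ?N * C $ (n - (i + m)))"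
      by (intro sum_mono2) (auto intro!: mult_nonneg_nonneg divide_nonneg_nonneg S_nonneg C_nonneg)
    also have "\<dots> = h n + (\<Sum>m\<in>{M..n-i}. S $ m / ?N * C $ (n - (i + m)))"
      unfolding h_def by (intro sum.union_disjoint) auto
    also have "(\<Sum>m\<in>{M..n-i}. S $ m / ?N * C $ (n - (i + m)))
        \<le> (\<Sum>m\<in>{M..n-i}. \<epsilon> / 2 * (B $ (m + i) * C $ (n - (m + i))))"
    proof (intro sum_mono)
      fix m assume m: "m \<in> {M..n-i}"
      have "0 \<le> \<epsilon> / 2 * B $ (m + i)" using \<epsilon> B_nonneg by simp
      then have "real m * (\<epsilon> / 2 * B $ (m + i)) \<le> ?N * (\<epsilon> / 2 * B $ (m + i))"
        using m by (intro mult_right_mono) auto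
      with M[of m] m have "S $ m \<le> ?N * (\<epsilon> / 2 * B $ (m + i))" by simp
      then have "S $ m / ?N \<le> \<epsilon> / 2 * B $ (m + i)"
        using N by (simp add: divide_le_eq mult_ac)
      from mult_right_mono[OF this C_nonneg[of "n - (i + m)"]]
      show "S $ m / ?N * C $ (n - (i + m)) \<le> \<epsilon> / 2 * (B $ (m + i) * C $ (n - (m + i)))"
        by (simp add: add.commute mult.assoc)
    qed
    \<comment> \<open>With \<open>l = m + i\<close> this becomes part of the convolution defining
      \<open>G $ n\<close>.\<close>
    also have "\<dots> = \<epsilon> / 2 * (\<Sum>l\<in>(\<lambda>m. m + i) ` {M..n-i}. B $ l * C $ (n - l))"
      by (subst sum.reindex) (simp_all add: sum_distrib_left)
    also have "\<dots> \<le> \<epsilon> / 2 * G $ n"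
      unfolding fps_mult_nth using \<epsilon>
      using elim(2) by (intro mult_left_mono sum_mono2) (auto intro!: mult_nonneg_nonneg B_nonneg C_nonneg)
    finally show ?case
      using elim C_nonneg[of "n - i"] G_nonneg[of n] by simp
  qed
qed

text \<open>
  The bound is trivial for large \<open>i\<close>, where \<open>B(i) \<ge> 1\<close>; it descends to small \<open>i\<close> because the step
  lemma only uses larger shifts.
\<close>
lemma C_shift_bigo: "(\<lambda>n. C $ (n - i)) \<in> O(\<lambda>n. G $ n)"
proof -
  \<comment> \<open>Chosen so that \<open>i / L - 1 \<ge> 1\<close> for all
    \<open>i \<ge> J\<close>.\<close>
  define J where "J = nat \<lceil>2 * L\<rceil>"
  have B1: "1 \<le> B $ i" if "J \<le> i" for i
  proof -
    have "2 * L \<le> real i" using that unfolding J_def by linarith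
    then have "1 \<le> real i / L - 1" using L_pos by (simp add: field_simps)
    with B_ge[of i] show ?thesis by simp
  qed
  \<comment> \<open>Here \<open>d\<close> bounds how far \<open>i\<close> lies below
    \<open>J\<close>; a shift \<open>i + m\<close> with \<open>m \<ge> 1\<close> has a smaller
    deficit.\<close>
  have "(\<lambda>n. C $ (n - i)) \<in> O(\<lambda>n. G $ n)" if "J \<le> i + d" for i d
    using that
  proof (induction d arbitrary: i)
    case 0
    show ?case
    proof (rule landau_o.bigI[of 1])
      show "\<forall>\<^sub>F n in sequentially. norm (C $ (n - i)) \<le> 1 * norm (G $ n)"
        using eventually_ge_at_top[of i]
      proof eventually_elim
        case (elim n)
        have "1 * C $ (n - i) \<le> B $ i * C $ (n - i)"
          using B1[of i] 0 C_nonneg by (intro mult_right_mono) auto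
        with G_ge_term[OF elim] C_nonneg[of "n - i"] show ?case by simp
      qed
    qed simp
  next
    case (Suc d)
    then have "(\<lambda>n. C $ (n - (i + m))) \<in> O(\<lambda>n. G $ n)" if "1 \<le> m" for m
      using that by (intro Suc.IH) simp
    then show ?case
      by (rule landau_o.small_imp_big[OF C_shift_smallo_step])
  qed
  from this[of i J] show ?thesis by simp
qed

lemma C_shift_smallo: "(\<lambda>n. C $ (n - i)) \<in> o(\<lambda>n. G $ n)"
  by (intro C_shift_smallo_step C_shift_bigo)

text \<open>For large \<open>i\<close> the weight 1 is at most
  \<open>\<epsilon> / 2 * B $ i\<close>, so those terms are dominated by \<open>G $ n\<close>; each
  of the finitely many others is \<open>o(G)\<close>.\<close>

lemma sum_C_smallo: "(\<lambda>n. \<Sum>i\<le>n. C $ (n - i)) \<in> o(\<lambda>n. G $ n)"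
proof (rule landau_o.smallI)
  fix \<epsilon> :: real assume \<epsilon>: "0 < \<epsilon>"
  have "filterlim (\<lambda>m. \<epsilon> / 2 * (real m / L - 1)) at_top sequentially"
    using L_pos \<epsilon> by real_asymp
  then have "\<forall>\<^sub>F m in sequentially. 1 \<le> \<epsilon> / 2 * (real m / L - 1)"
    unfolding filterlim_at_top by blast
  then obtain M where M: "\<And>m. M \<le> m \<Longrightarrow> 1 \<le> \<epsilon> / 2 * (real m / L - 1)"
    by (auto simp: eventually_sequentially)
  have "(\<lambda>n. \<Sum>i<M. C $ (n - i)) \<in> o(\<lambda>n. G $ n)"
    by (intro big_sum_in_smallo C_shift_smallo)
  then have "\<forall>\<^sub>F n in sequentially. norm (\<Sum>i<M. C $ (n - i)) \<le> \<epsilon> / 2 * norm (G $ n)"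
    using \<epsilon> by (intro landau_o.smallD) auto
  then show "\<forall>\<^sub>F n in sequentially. norm (\<Sum>i\<le>n. C $ (n - i)) \<le> \<epsilon> * norm (G $ n)"
  proof eventually_elim
    case (elim n)
    have "(\<Sum>i\<le>n. C $ (n - i)) \<le> (\<Sum>i\<in>{..<M} \<union> {M..n}. C $ (n - i))"
      by (intro sum_mono2) (auto intro!: C_nonneg)
    also have "\<dots> = (\<Sum>i<M. C $ (n - i)) + (\<Sum>i\<in>{M..n}. C $ (n - i))"
      by (intro sum.union_disjoint) auto
    also have "(\<Sum>i\<in>{M..n}. C $ (n - i)) \<le> (\<Sum>i\<in>{M..n}. \<epsilon> / 2 * (B $ i * C $ (n - i)))"
    proof (intro sum_mono)
      fix i assume "i \<in> {M..n}"
      then have "1 \<le> \<epsilon> / 2 * (real i / L - 1)" using M by simp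
      also have "\<dots> \<le> \<epsilon> / 2 * B $ i" using \<epsilon> B_ge by (intro mult_left_mono) auto
      finally have "1 \<le> \<epsilon> / 2 * B $ i" .
      from mult_right_mono[OF this C_nonneg[of "n - i"]]
      show "C $ (n - i) \<le> \<epsilon> / 2 * (B $ i * C $ (n - i))"
        by (simp add: mult.assoc)
    qed
    also have "\<dots> \<le> \<epsilon> / 2 * G $ n"
      unfolding fps_mult_nth sum_distrib_left[symmetric] using \<epsilon>
      by (intro mult_left_mono sum_mono2) (auto intro!: mult_nonneg_nonneg B_nonneg C_nonneg)
    finally show ?case
      using elim sum_nonneg[of "{..n}" "\<lambda>i. C $ (n - i)"] C_nonneg G_nonneg[of n] by simp
  qed
qed

text \<open>Since \<open>(1 - X) G = ((1 - X) B) C\<close>, bounded differences of \<open>B\<close>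
  reduce the case \<open>i = 1\<close> to \<open>sum_C_smallo\<close>; larger shifts
  telescope.\<close>

lemma G_diff_smallo:
  assumes "\<And>n. \<bar>((1 - fps_X) * B) $ n\<bar> \<le> K"
  shows "(\<lambda>n. G $ n - G $ (n - i)) \<in> o(\<lambda>n. G $ n)"
proof -
  have 1: "(\<lambda>n. G $ n - G $ (n - 1)) \<in> o(\<lambda>n. G $ n)"
  proof (rule landau_o.big_small_trans[OF landau_o.bigI sum_C_smallo])
    show "0 < \<bar>K\<bar> + 1" by simp
    show "\<forall>\<^sub>F n in sequentially. norm (G $ n - G $ (n - 1)) \<le> (\<bar>K\<bar> + 1) * norm (\<Sum>i\<le>n. C $ (n - i))"
      using eventually_gt_at_top[of 0]
    proof eventually_elim
      case (elim n)
      have "G $ n - G $ (n - 1) = ((1 - fps_X) * G) $ n"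
        using elim by (simp only: left_diff_distrib fps_sub_nth mult_1 fps_X_mult_nth) simp
      also have "\<dots> = (((1 - fps_X) * B) * C) $ n"
        by (simp only: mult.assoc)
      also have "\<dots> = (\<Sum>i\<le>n. ((1 - fps_X) * B) $ i * C $ (n - i))"
        by (simp only: fps_mult_nth[of "(1 - fps_X) * B"] atLeast0AtMost)
      also have "\<bar>\<dots>\<bar> \<le> (\<Sum>i\<le>n. (\<bar>K\<bar> + 1) * C $ (n - i))"
      proof (intro order.trans[OF sum_abs] sum_mono)
        fix i
        show "\<bar>((1 - fps_X) * B) $ i * C $ (n - i)\<bar> \<le> (\<bar>K\<bar> + 1) * C $ (n - i)"
          unfolding abs_mult using C_nonneg assms[of i] by (intro mult_mono) auto
      qed
      also have "\<dots> = (\<bar>K\<bar> + 1) * norm (\<Sum>i\<le>n. C $ (n - i))"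
        by (simp add: sum_distrib_left sum_nonneg C_nonneg)
      finally show ?case by simp
    qed
  qed
  show ?thesis
  proof (induction i)
    case (Suc i)
    \<comment> \<open>The induction hypothesis also gives \<open>G $ (n - i) = O(G $ n)\<close>, so
      an error relative to the shifted value is one relative to \<open>G $ n\<close>.\<close>
    have "(\<lambda>n. G $ n - (G $ n - G $ (n - i))) \<in> O(\<lambda>n. G $ n)"
      by (rule sum_in_bigo(2)[OF landau_o.big_refl landau_o.small_imp_big[OF Suc.IH]])
    then have "(\<lambda>n. G $ (n - i)) \<in> O(\<lambda>n. G $ n)" by simp
    moreover have "(\<lambda>n. G $ (n - i) - G $ (n - i - 1)) \<in> o(\<lambda>n. G $ (n - i))"
      using 1 by (rule landau_o.small.compose) (rule filterlim_minus_const_nat_at_top)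
    ultimately have "(\<lambda>n. G $ (n - i) - G $ (n - i - 1)) \<in> o(\<lambda>n. G $ n)"
      by (rule landau_o.small_big_trans[rotated])
    from sum_in_smallo(1)[OF Suc.IH this] show ?case by simp
  qed simp
qed

text \<open>Coefficient \<open>n\<close> is \<open>W G(n) + o(G(n)) + O(1)\<close> with
  \<open>W > 0\<close>. Half of the main term absorbs the shifts, the other half outgrows
  \<open>M\<close>.\<close>

lemma eventually_nonneg_combination:
  fixes w :: "'t \<Rightarrow> real" and e :: "'t \<Rightarrow> nat"
  assumes "\<And>n. \<bar>((1 - fps_X) * B) $ n\<bar> \<le> K"
    and "finite T" "0 < (\<Sum>t\<in>T. w t)" "\<And>n. \<bar>E $ n\<bar> \<le> M"
  shows "\<forall>\<^sub>F n in sequentially. 0 \<le> ((\<Sum>t\<in>T. fps_const (w t) * fps_X ^ e t) * G + E) $ n"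
proof -
  define W where "W = (\<Sum>t\<in>T. w t)"
  have "(\<lambda>n. \<Sum>t\<in>T. w t * (G $ n - G $ (n - e t))) \<in> o(\<lambda>n. G $ n)"
  proof (rule big_sum_in_smallo)
    fix t
    show "(\<lambda>n. w t * (G $ n - G $ (n - e t))) \<in> o(\<lambda>n. G $ n)"
      using G_diff_smallo[OF assms(1), of "e t"] by (cases "w t = 0") simp_all
  qed
  then have "\<forall>\<^sub>F n in sequentially. norm (\<Sum>t\<in>T. w t * (G $ n - G $ (n - e t))) \<le> W / 2 * norm (G $ n)"
    using assms(3) by (intro landau_o.smallD) (auto simp: W_def)
  moreover have "\<forall>\<^sub>F n in sequentially. 2 * M / W \<le> G $ n"
    using G_at_top by (simp add: filterlim_at_top)
  moreover have "\<forall>\<^sub>F n in sequentially. \<forall>t\<in>T. e t \<le> n"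
    using assms(2) by (intro eventually_ball_finite ballI eventually_ge_at_top)
  ultimately show ?thesis
  proof eventually_elim
    case (elim n)
    have "((\<Sum>t\<in>T. fps_const (w t) * fps_X ^ e t) * G) $ n = (\<Sum>t\<in>T. w t * G $ (n - e t))"
      unfolding sum_distrib_right fps_sum_nth mult.assoc fps_mult_left_const_nth fps_X_power_mult_nth
      using elim(3) by (intro sum.cong) auto
    also have "\<dots> = W * G $ n - (\<Sum>t\<in>T. w t * (G $ n - G $ (n - e t)))"
      by (simp add: W_def sum_subtractf sum_distrib_right right_diff_distrib)
    also have "\<dots> \<ge> W / 2 * G $ n"
      using elim(1) G_nonneg[of n] by (simp add: abs_le_iff)
    also have "W / 2 * G $ n \<ge> M"
      using elim(2) assms(3) by (simp add: W_def field_simps)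
    finally show ?case
      using assms(4)[of n] by (simp add: abs_le_iff)
  qed
qed

end

subsection \<open>Expansions of the analytic functions\<close>

text \<open>Positivity is argued over the reals, whereas the Taylor series of the given function is
  complex.\<close>

definition fps_of_real :: "real fps \<Rightarrow> complex fps" where
  "fps_of_real F = Abs_fps (\<lambda>n. complex_of_real (F $ n))"

lemma fps_of_real_nth [simp]: "fps_of_real F $ n = complex_of_real (F $ n)"
  by (simp add: fps_of_real_def)

lemma fps_of_real_1: "fps_of_real 1 = 1"
  by (rule fps_ext) simp

lemma fps_of_real_mult: "fps_of_real (F * G) = fps_of_real F * fps_of_real G"
  by (rule fps_ext) (simp add: fps_mult_nth)

lemma fps_of_real_prod: "fps_of_real (prod f A) = (\<Prod>i\<in>A. fps_of_real (f i))"
  by (induction A rule: infinite_finite_induct) (simp_all add: fps_of_real_1 fps_of_real_mult)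

lemma fps_of_real_one_minus_X_power: "fps_of_real (1 - fps_X ^ d) = 1 - fps_X ^ d"
  by (rule fps_ext) simp

lemma fps_of_real_inverse:
  assumes "F $ 0 \<noteq> 0"
  shows "fps_of_real (inverse F) = inverse (fps_of_real F)"
proof -
  have "fps_of_real F * fps_of_real (inverse F) = 1"
    by (simp only: fps_of_real_mult[symmetric] inverse_mult_eq_1'[OF assms] fps_of_real_1)
  then show ?thesis
    using fps_inverse_unique by metis
qed

lemma fps_of_real_euler_fps: "fps_of_real (euler_fps f) = euler_fps f"
proof (rule fps_ext)
  fix n
  have "complex_of_real ((\<Prod>i\<le>n. 1 - fps_X ^ f i) $ n) = (\<Prod>i\<le>n. 1 - fps_X ^ f i) $ n"
    by (simp only: fps_of_real_nth[symmetric] fps_of_real_prod fps_of_real_one_minus_X_power)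
  then show "fps_of_real (euler_fps f) $ n = euler_fps f $ n"
    by (simp add: euler_fps_def)
qed

lemma fps_of_real_theta_fps: "fps_of_real (theta_fps r s k) = theta_fps r s k"
  by (rule fps_ext) (auto simp: theta_fps_def of_bool_def intro!: sum.cong)

text \<open>A uniform limit of holomorphic functions is holomorphic, and Taylor coefficients pass to
  the limit. The general filter covers both the infinite product and the unordered sum.\<close>

lemma has_fps_expansion_uniform_limit:
  fixes f :: "'a \<Rightarrow> complex \<Rightarrow> complex"
  assumes lim: "(F \<longlongrightarrow> H) net" "uniform_limit (cball 0 \<rho>) f g net"
    and f: "\<And>x. f x has_fps_expansion F x" "\<And>x. f x holomorphic_on UNIV"
    and "0 < \<rho>" "net \<noteq> bot"
  shows "g has_fps_expansion H"
proof -
  have "\<forall>\<^sub>F x in net. continuous_on (cball 0 \<rho>) (f x) \<and> f x holomorphic_on ball 0 \<rho>"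
    using f(2) by (auto intro!: always_eventually intro: holomorphic_on_imp_continuous_on holomorphic_on_subset)
  then have "g holomorphic_on ball 0 \<rho>"
    using holomorphic_uniform_limit lim(2) assms(6) by blast
  then have g: "g has_fps_expansion fps_expansion g 0"
    using assms(5) by (intro has_fps_expansion_fps_expansion[of "ball 0 \<rho>"]) auto
  moreover have "fps_expansion g 0 = H"
  proof (rule uniform_limit_imp_fps_expansion_eq[OF lim(1) _ _ g])
    show "uniform_limit (ball 0 \<rho>) f g net"
      using lim(2) by (rule uniform_limit_on_subset) auto
    show "\<forall>\<^sub>F x in net. f x holomorphic_on ball 0 \<rho>"
      using f(2) by (auto intro!: always_eventually intro: holomorphic_on_subset)
  qed (use f(1) assms(5,6) in auto)
  ultimately show ?thesis by simp
qed

text \<open>On the disc of radius 1/2, factor \<open>n\<close> differs from 1 by at most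
  \<open>2^(-n)\<close>, because \<open>a + r n \<ge> n\<close>; the partial products therefore
  converge uniformly.\<close>

lemma qpoch_inf_has_fps_expansion:
  assumes "0 < a" "0 < r"
  shows "(\<lambda>q. qpoch_inf (q ^ a) (q ^ r)) has_fps_expansion euler_fps (\<lambda>i. a + r * i)"
proof (rule has_fps_expansion_uniform_limit[where \<rho> = "1/2" and net = sequentially])
  let ?f = "\<lambda>n q. 1 - q ^ a * (q ^ r) ^ n :: complex"
  have eq: "q ^ a * (q ^ r) ^ n = q ^ (a + r * n)" for q :: complex and n
    by (simp add: power_add power_mult)
  have lt: "i < a + r * i" for i
  proof -
    have "i \<le> r * i" using assms by simp
    then show ?thesis using assms by linarith
  qed
  have bound: "norm (?f n q - 1) \<le> (1 / 2) ^ n" if "q \<in> cball 0 (1/2)" for n q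
  proof -
    have "norm (?f n q - 1) = norm q ^ (a + r * n)"
      by (simp add: eq norm_power)
    also have "\<dots> \<le> (1 / 2) ^ (a + r * n)"
      using that by (intro power_mono) auto
    also have "\<dots> \<le> (1 / 2) ^ n"
      using lt[of n] by (intro power_decreasing) auto
    finally show ?thesis .
  qed
  have sm: "summable (\<lambda>n. (1 / 2) ^ n :: real)"
    by (intro summable_geometric) auto
  show "(\<lambda>N. \<Prod>i<N. 1 - fps_X ^ (a + r * i)) \<longlonglongrightarrow> euler_fps (\<lambda>i. a + r * i)"
    using lt by (rule tendsto_euler_fps)
  have "uniformly_convergent_on (cball 0 (1/2)) (\<lambda>N q. \<Sum>n<N. norm (?f n q - 1))"
    by (rule Weierstrass_m_test'[OF _ sm]) (use bound in simp)
  then have "uniformly_convergent_on (cball 0 (1/2)) (\<lambda>N q. \<Prod>n<N. ?f n q)"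
    by (intro uniformly_convergent_on_prod') (auto intro!: continuous_intros)
  then have "uniform_limit (cball 0 (1/2)) (\<lambda>N q. \<Prod>n<N. ?f n q) (\<lambda>q. lim (\<lambda>N. \<Prod>n<N. ?f n q)) sequentially"
    by (simp only: uniformly_convergent_uniform_limit_iff)
  moreover have "lim (\<lambda>N. \<Prod>n<N. ?f n q) = qpoch_inf (q ^ a) (q ^ r)" if "q \<in> cball 0 (1/2)" for q
  proof (rule limI)
    have "summable (\<lambda>n. norm (?f n q - 1))"
      by (rule summable_comparison_test'[OF sm, of 0]) (use bound[OF that] in simp)
    then have "convergent_prod (\<lambda>n. ?f n q)"
      by (intro abs_convergent_prod_imp_convergent_prod summable_imp_abs_convergent_prod)
    then show "(\<lambda>N. \<Prod>n<N. ?f n q) \<longlonglongrightarrow> qpoch_inf (q ^ a) (q ^ r)"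
      unfolding qpoch_inf_def LIMSEQ_lessThan_iff_atMost by (rule convergent_prod_LIMSEQ)
  qed
  ultimately show "uniform_limit (cball 0 (1/2)) (\<lambda>N q. \<Prod>i<N. 1 - q ^ (a + r * i)) (\<lambda>q. qpoch_inf (q ^ a) (q ^ r)) sequentially"
    unfolding eq by (subst (asm) uniform_limit_cong') auto
qed (auto intro!: fps_expansion_intros holomorphic_intros)

lemma truncated_theta_term:
  assumes "0 < s" "s < r"
  shows "(-1) ^ j * q ^ (r * (j * (j + 1) div 2)) * (q powi (- (int s * int j)) - q ^ ((j + 1) * s))
    = (-1) ^ j * (q ^ theta_exp1 r s j - q ^ theta_exp2 r s j :: complex)"
proof -
  have e: "r * (j * (j + 1) div 2) = r * (Suc j choose 2)"
    by (simp add: choose_two mult.commute)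
  have "q ^ (r * (Suc j choose 2)) * q ^ ((j + 1) * s) = q ^ theta_exp2 r s j"
    by (simp add: theta_exp2_def power_add mult_ac)
  moreover have "q ^ (r * (Suc j choose 2)) * q powi (- (int s * int j)) = q ^ theta_exp1 r s j"
  \<comment> \<open>At \<open>q = 0\<close> and \<open>j > 0\<close> both sides vanish because both
    natural-number exponents are positive; at \<open>j = 0\<close> both are 1.\<close>
  proof (cases "q = 0")
    case True
    show ?thesis
    proof (cases "j = 0")
      case False
      then have "0 < theta_exp1 r s j" "0 < Suc j choose 2"
        using theta_exp1_ge[OF assms(2), of j] Suc_choose_two_ge[of j] by linarith+
      then show ?thesis using True assms by simp
    qed (simp add: theta_exp1_def binomial_eq_0)
  next
    case False
    have "q powi (- (int s * int j)) = inverse (q ^ (s * j))"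
      by (simp add: power_int_minus flip: of_nat_mult)
    then show ?thesis
      using False assms unfolding theta_exp1_add[OF less_imp_le[OF assms(2)], symmetric] power_add by simp
  qed
  ultimately show ?thesis
    unfolding e by (simp add: right_diff_distrib mult.assoc)
qed

text \<open>Both exponents are at least \<open>j\<close>, so \<open>2 * (1/2)^j\<close> majorizes
  the terms on the disc of radius 1/2.\<close>

lemma truncated_theta_has_fps_expansion:
  assumes "0 < s" "s < r"
  shows "truncated_theta r s k has_fps_expansion theta_fps r s k"
proof (rule has_fps_expansion_uniform_limit[where \<rho> = "1/2" and net = "finite_subsets_at_top {k..}"])
  let ?f = "\<lambda>j q. (-1) ^ j * (q ^ theta_exp1 r s j - q ^ theta_exp2 r s j :: complex)"
  have bound: "norm (?f j q) \<le> 2 * (1 / 2) ^ j" if "q \<in> cball 0 (1/2)" for j q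
  proof -
    have le: "norm (q ^ e) \<le> (1 / 2) ^ j" if "j \<le> e" for e
    proof -
      have "norm (q ^ e) \<le> (1 / 2) ^ e"
        using \<open>q \<in> cball 0 (1/2)\<close> by (simp add: norm_power power_mono)
      also have "\<dots> \<le> (1 / 2) ^ j"
        using that by (intro power_decreasing) auto
      finally show ?thesis .
    qed
    have "norm (?f j q) \<le> norm (q ^ theta_exp1 r s j) + norm (q ^ theta_exp2 r s j)"
      unfolding norm_mult norm_power norm_minus_cancel norm_one power_one mult_1
      by (rule order.trans[OF norm_triangle_ineq4]) (simp add: norm_power)
    also have "\<dots> \<le> (1 / 2) ^ j + (1 / 2) ^ j"
      using theta_exp1_ge[OF assms(2), of j] theta_exp2_ge[OF assms(1), of j r]
      by (intro add_mono le) auto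
    finally show ?thesis by simp
  qed
  have "(\<lambda>j. 2 * (1 / 2) ^ j :: real) summable_on {k..}"
  proof (rule summable_on_subset_banach[OF norm_summable_imp_summable_on])
    show "summable (\<lambda>j. norm (2 * (1 / 2) ^ j :: real))"
      by (simp add: summable_mult summable_geometric)
  qed simp
  then have "uniform_limit (cball 0 (1/2)) (\<lambda>X q. \<Sum>j\<in>X. ?f j q) (\<lambda>q. \<Sum>\<^sub>\<infinity>j\<in>{k..}. ?f j q) (finite_subsets_at_top {k..})"
    using bound by (intro Weierstrass_m_test_general)
  moreover have "truncated_theta r s k = (\<lambda>q. \<Sum>\<^sub>\<infinity>j\<in>{k..}. ?f j q)"
    unfolding truncated_theta_def truncated_theta_term[OF assms] by (rule refl)
  ultimately show "uniform_limit (cball 0 (1/2)) (\<lambda>X q. \<Sum>j\<in>X. ?f j q) (truncated_theta r s k) (finite_subsets_at_top {k..})"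
    by (simp only:)
  let ?F = "\<lambda>j. (-1) ^ j * (fps_X ^ theta_exp1 r s j - fps_X ^ theta_exp2 r s j) :: complex fps"
  show "((\<lambda>X. \<Sum>j\<in>X. ?F j) \<longlongrightarrow> theta_fps r s k) (finite_subsets_at_top {k..})"
  proof (rule tendsto_fpsI)
    fix n
    \<comment> \<open>Every finite index set containing \<open>{k..<Suc n}\<close> already gives the
      final coefficient \<open>n\<close>.\<close>
    have "\<forall>\<^sub>F X in finite_subsets_at_top {k..}. finite X \<and> {k..<Suc n} \<subseteq> X \<and> X \<subseteq> {k..}"
      unfolding eventually_finite_subsets_at_top by (rule exI[of _ "{k..<Suc n}"]) auto
    then show "\<forall>\<^sub>F X in finite_subsets_at_top {k..}. (\<Sum>j\<in>X. ?F j) $ n = theta_fps r s k $ n"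
    proof eventually_elim
      case (elim X)
      have sgn: "((-1) ^ j * f) $ n = (-1) ^ j * f $ n" for j and f :: "complex fps"
        by (cases "even j") auto
      have "?F j $ n = 0" if "j \<in> X - {k..<Suc n}" for j
        using that elim theta_exp1_ge[OF assms(2), of j] theta_exp2_ge[OF assms(1), of j r]
        unfolding sgn by (auto simp: subset_iff)
      then have "(\<Sum>j\<in>X. ?F j) $ n = (\<Sum>j\<in>{k..<Suc n}. ?F j) $ n"
        unfolding fps_sum_nth using elim by (intro sum.mono_neutral_right) auto
      then show ?case
        using theta_fps_nth[OF assms, of n "Suc n" k, where 'a = complex] by simp
    qed
  qed
  show "(\<lambda>q. \<Sum>j\<in>X. ?f j q) has_fps_expansion (\<Sum>j\<in>X. ?F j)" for X
  proof -
    have "(\<lambda>q. (-1) ^ j) has_fps_expansion ((-1) ^ j :: complex fps)" for j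
      using has_fps_expansion_minus[OF has_fps_expansion_1] by (cases "even j") auto
    then show ?thesis
      by (intro has_fps_expansion_sum has_fps_expansion_mult has_fps_expansion_diff has_fps_expansion_fps_X_power)
  qed
qed (auto intro!: holomorphic_intros)

subsection \<open>Asymptotic positivity\<close>

lemma theta_fps_split:
  assumes "0 < s" "s < r"
  shows "theta_fps r s 0 = (\<Sum>j<k. (-1) ^ j * (fps_X ^ theta_exp1 r s j - fps_X ^ theta_exp2 r s j))
    + (theta_fps r s k :: 'a::comm_ring_1 fps)"
proof (rule fps_ext)
  fix n
  let ?F = "\<lambda>j. (-1) ^ j * (fps_X ^ theta_exp1 r s j - fps_X ^ theta_exp2 r s j) :: 'a fps"
  let ?N = "n + k + 1"
  have "(\<Sum>j\<in>{0..<?N}. ?F j) = (\<Sum>j\<in>{0..<k}. ?F j) + (\<Sum>j\<in>{k..<?N}. ?F j)"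
    by (intro sum.atLeastLessThan_concat[symmetric]) auto
  then show "theta_fps r s 0 $ n = ((\<Sum>j<k. ?F j) + theta_fps r s k) $ n"
    using theta_fps_nth[OF assms, of n ?N 0, where 'a = 'a] theta_fps_nth[OF assms, of n ?N k, where 'a = 'a]
    by (simp only: lessThan_atLeast0 fps_add_nth)
qed

text \<open>The exponents differ by \<open>(2 j + 1) s\<close>. The factor \<open>1 - X^s\<close>
  cancels the part \<open>s\<close> in the denominator, and the cofactor has value
  \<open>2 j + 1\<close> at \<open>X = 1\<close>.\<close>

lemma theta_term_factor:
  assumes "s \<le> r"
  shows "fps_X ^ theta_exp1 r s j - fps_X ^ theta_exp2 r s j
    = (1 - fps_X ^ s) * (\<Sum>i<2 * j + 1. fps_X ^ (theta_exp1 r s j + s * i) :: 'a::comm_ring_1 fps)"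
proof -
  have "(1 - fps_X ^ s) * (\<Sum>i<2 * j + 1. fps_X ^ (theta_exp1 r s j + s * i) :: 'a fps)
      = fps_X ^ theta_exp1 r s j * ((1 - fps_X ^ s) * (\<Sum>i<2 * j + 1. (fps_X ^ s) ^ i))"
    by (simp only: power_add power_mult sum_distrib_left[symmetric] mult.left_commute)
  also have "\<dots> = fps_X ^ theta_exp1 r s j * (1 - (fps_X ^ s) ^ (2 * j + 1))"
    by (simp only: one_diff_power_eq)
  also have "\<dots> = fps_X ^ theta_exp1 r s j - fps_X ^ theta_exp2 r s j"
    unfolding theta_exp2_eq[OF assms] power_add[of fps_X] right_diff_distrib mult_1_right
    by (simp only: power_mult[symmetric] mult.commute)
  finally show ?thesis by simp
qed

text \<open>Up to sign, the value at 1 of the polynomial multiplying \<open>G\<close>.\<close>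

lemma alternating_odd_sum: "(\<Sum>j<k. (-1) ^ j * (2 * real j + 1)) = (-1) ^ (k + 1) * real k"
  by (induction k) (simp_all add: algebra_simps)

lemma harm_over_self_tendsto_0: "(\<lambda>m. harm m / real m) \<longlonglongrightarrow> 0"
proof -
  have "(\<lambda>m. (harm m - ln (real m)) * (1 / real m) + ln (real m) / real m) \<longlonglongrightarrow> euler_mascheroni * 0 + 0"
    by (intro tendsto_add tendsto_mult euler_mascheroni_LIMSEQ) real_asymp+
  moreover have "(harm m - ln (real m)) * (1 / real m) + ln (real m) / real m = harm m / real m" for m
    by (simp add: diff_divide_distrib)
  ultimately show ?thesis by simp
qed

text \<open>Inverting the product reverses the sign of its logarithmic derivative, so
  \<open>S\<close> becomes a nonnegative sum of divisor sums, at most \<open>2 m\<close> times the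
  harmonic number.\<close>

lemma partition_growth_two_parts:
  assumes "0 < x" "0 < y" "coprime x y"
    and f: "inj f" "\<And>i. i < f i" and g: "inj g" "\<And>i. i < g i"
  shows "partition_growth (two_parts x y) (inverse (euler_fps f * euler_fps g)) (sigma_fps f + sigma_fps g) (real (x * y))"
proof
  let ?a = "euler_fps f * euler_fps g :: real fps" and ?S = "sigma_fps f + sigma_fps g :: real fps"
  have a0: "?a $ 0 = 1"
    using f g by simp
  show "inverse ?a $ 0 = 1"
    using a0 by simp
  show "0 \<le> ?S $ m" for m
    using sigma_fps_nth_nonneg by simp
  have "fps_X * fps_deriv ?a = euler_fps f * (fps_X * fps_deriv (euler_fps g)) + fps_X * fps_deriv (euler_fps f) * euler_fps g"
    by (simp add: algebra_simps)
  also have "\<dots> = - (?a * ?S)"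
    unfolding euler_fps_log_deriv[OF f(2)] euler_fps_log_deriv[OF g(2)] by (simp add: algebra_simps)
  finally have deriv: "fps_X * fps_deriv ?a = - (?a * ?S)" .
  have inv: "?a * inverse ?a = 1"
    using a0 by (intro inverse_mult_eq_1') simp
  have "fps_X * fps_deriv (inverse ?a) = - (fps_X * fps_deriv ?a) * (inverse ?a)\<^sup>2"
    using a0 by (subst fps_inverse_deriv) (simp_all only: mult.assoc mult_minus_left mult_minus_right one_neq_zero not_False_eq_True)
  also have "\<dots> = (?a * inverse ?a) * (inverse ?a * ?S)"
    unfolding deriv by (simp only: power2_eq_square minus_minus mult_ac)
  finally show "fps_X * fps_deriv (inverse ?a) = inverse ?a * ?S"
    unfolding inv by simp
  show "(\<lambda>m. ?S $ m / (real m)\<^sup>2) \<longlonglongrightarrow> 0"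
  proof (rule tendsto_sandwich[OF _ _ tendsto_const])
    show "(\<lambda>m. 2 * (harm m / real m)) \<longlonglongrightarrow> 0"
      using tendsto_mult_right_zero[OF harm_over_self_tendsto_0] .
    show "\<forall>\<^sub>F m in sequentially. ?S $ m / (real m)\<^sup>2 \<le> 2 * (harm m / real m)"
    proof (rule always_eventually, rule allI)
      fix m
      have "?S $ m \<le> 2 * (real m * harm m)"
        using sigma_fps_nth_le[OF f, of m] sigma_fps_nth_le[OF g, of m] by simp
      then have "?S $ m / (real m)\<^sup>2 \<le> 2 * (real m * harm m) / (real m)\<^sup>2"
        by (intro divide_right_mono) auto
      then show "?S $ m / (real m)\<^sup>2 \<le> 2 * (harm m / real m)"
        by (cases "m = 0") (simp_all add: power2_eq_square)
    qed
  qed (use sigma_fps_nth_nonneg in simp)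
  show "0 < real (x * y)"
    using assms by simp
  show "0 \<le> two_parts x y $ m" "real m / real (x * y) - 1 \<le> two_parts x y $ m" for m
    using two_parts_nth[OF assms(1,2)] two_parts_nth_ge[OF assms(1-3)] by simp_all
qed

lemma eventually_quotient_nonneg:
  fixes r s k :: nat
  assumes "coprime r s" "1 \<le> s" "2 * s < r" "1 \<le> k"
  shows "\<forall>\<^sub>F n in sequentially. 0 \<le> ((-1) ^ k * (theta_fps r s k
    * inverse (euler_fps (\<lambda>i. s + r * i) * euler_fps (\<lambda>i. r - s + r * i))) :: real fps) $ n"
proof -
  \<comment> \<open>The parts split off are \<open>r - s\<close> and \<open>2 r - s\<close>: a
    common divisor divides their difference \<open>r\<close>, hence also \<open>s\<close>.\<close>
  define x where "x = r - s"
  define y where "y = r - s + r"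
  \<comment> \<open>The remaining parts: \<open>f\<close> starts after \<open>s\<close> in its
    class, \<open>g\<close> after \<open>x\<close> and \<open>y\<close>.\<close>
  define f where "f = (\<lambda>i. s + r * Suc i)"
  define g where "g = (\<lambda>i. r - s + r * Suc (Suc i))"
  have sr: "0 < s" "s < r" using assms by auto
  have xy: "0 < x" "0 < y" using sr by (auto simp: x_def y_def)
  have r: "r = x + s" using sr by (simp add: x_def)
  have cop: "coprime x y"
    using assms(1) unfolding y_def x_def[symmetric] r by (simp add: coprime_iff_gcd_eq_1)
  have le: "i \<le> r * i" for i using sr by simp
  have fg: "inj f" "\<And>i. i < f i" "inj g" "\<And>i. i < g i"
  proof -
    show "inj f" "inj g"
      using sr unfolding f_def g_def inj_def add_left_cancel mult_cancel1 by auto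
    show "i < f i" "i < g i" for i
      using sr le[of i] unfolding f_def g_def mult_Suc_right by linarith+
  qed
  interpret partition_growth "two_parts x y" "inverse (euler_fps f * euler_fps g)" "sigma_fps f + sigma_fps g" "real (x * y)"
    by (intro partition_growth_two_parts xy cop fg)
  let ?G = "two_parts x y * inverse (euler_fps f * euler_fps g)"
  define V where "V = inverse (euler_fps (\<lambda>i. s + r * i) * euler_fps (\<lambda>i. r - s + r * i) :: real fps)"
  have lt: "i < s + r * i" "i < r - s + r * i" "i < r - s + r * Suc i" for i
    using le[of i] sr unfolding mult_Suc_right by linarith+
  have "euler_fps (\<lambda>i. s + r * i) = (1 - fps_X ^ s) * (euler_fps f :: real fps)"
    using euler_fps_Suc[OF lt(1), where 'a = real] by (simp only: f_def mult_0_right add_0_right)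
  moreover have "euler_fps (\<lambda>i. r - s + r * i) = (1 - fps_X ^ x) * ((1 - fps_X ^ y) * (euler_fps g :: real fps))"
    using euler_fps_Suc[OF lt(2), where 'a = real] euler_fps_Suc[OF lt(3), where 'a = real]
    by (simp only: g_def x_def y_def mult_0_right add_0_right mult_Suc_right)
  ultimately have "V = inverse (1 - fps_X ^ s) * ?G"
    unfolding V_def two_parts_def by (simp only: fps_inverse_mult mult_ac)
  moreover have "(1 - fps_X ^ s) * inverse (1 - fps_X ^ s) = (1 :: real fps)"
    using sr by (intro inverse_mult_eq_1') simp
  ultimately have V: "(1 - fps_X ^ s) * V = ?G"
    by (simp only: mult.assoc[symmetric] mult_1_left)
  have DV: "(euler_fps (\<lambda>i. s + r * i) * euler_fps (\<lambda>i. r - s + r * i)) * V = 1"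
    unfolding V_def using lt by (intro inverse_mult_eq_1') simp
  define E where "E = (-1) ^ k * (euler_fps (\<lambda>i. r * Suc i) :: real fps)"
  have E: "\<bar>E $ n\<bar> \<le> 2" for n
    using theta_fps_nth_abs_le[of r "3 * r" 0 n] euler_fps_eq_theta[of r, where 'a = real] sr
    by (cases "even k") (simp_all add: E_def)
  \<comment> \<open>One index for each monomial of the first \<open>k\<close> factored theta terms.
    In the sign \<open>w\<close>, \<open>k\<close> comes from the prefactor, \<open>j\<close> from
    the series and 1 from subtracting these terms.\<close>
  define T where "T = (SIGMA j:{..<k}. {..<2 * j + 1})"
  define w where "w = (\<lambda>(j, i :: nat). (-1) ^ (k + 1 + j) :: real)"
  define e where "e = (\<lambda>(j, i). theta_exp1 r s j + s * i)"
  have w: "0 < (\<Sum>t\<in>T. w t)"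
  proof -
    have "(\<Sum>t\<in>T. w t) = (\<Sum>j<k. \<Sum>i<2 * j + 1. (-1) ^ (k + 1 + j))"
      unfolding T_def w_def by (subst sum.Sigma) auto
    also have "\<dots> = (-1) ^ (k + 1) * (\<Sum>j<k. (-1) ^ j * (2 * real j + 1))"
      unfolding sum_distrib_left by (intro sum.cong) (simp_all add: power_add algebra_simps)
    also have "\<dots> = real k"
      unfolding alternating_odd_sum by (simp flip: power_add mult.assoc)
    finally show ?thesis using assms(4) by simp
  qed
  have "(-1) ^ k * (theta_fps r s k * V) = (\<Sum>t\<in>T. fps_const (w t) * fps_X ^ e t) * ?G + E"
  proof -
    let ?H = "\<lambda>j. \<Sum>i<2 * j + 1. fps_X ^ (theta_exp1 r s j + s * i) :: real fps"
    have const: "fps_const ((-1) ^ j) = ((-1) ^ j :: real fps)" for j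
      by (cases "even j") (auto simp flip: fps_const_neg)
    let ?A = "euler_fps (\<lambda>i. s + r * i) * euler_fps (\<lambda>i. r - s + r * i) :: real fps"
    \<comment> \<open>The tail is the full triple product minus its first \<open>k\<close> terms;
      multiplied by \<open>V\<close>, the former leaves \<open>euler_fps\<close> for
      \<open>r\<close>, the latter multiples of \<open>?G\<close>.\<close>
    have "theta_fps r s k = ?A * euler_fps (\<lambda>i. r * Suc i) - (\<Sum>j<k. (-1) ^ j * ((1 - fps_X ^ s) * ?H j))"
      using theta_fps_split[OF sr, of k, where 'a = real]
      unfolding jacobi_triple_product_fps[OF sr] theta_term_factor[OF less_imp_le[OF sr(2)]] by simp
    then have "theta_fps r s k * V
        = ?A * euler_fps (\<lambda>i. r * Suc i) * V - (\<Sum>j<k. (-1) ^ j * ((1 - fps_X ^ s) * ?H j)) * V"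
      by (simp only: left_diff_distrib[of "?A * euler_fps (\<lambda>i. r * Suc i)"])
    also have "?A * euler_fps (\<lambda>i. r * Suc i) * V = ?A * V * euler_fps (\<lambda>i. r * Suc i)"
      by (simp only: mult_ac)
    also have "(\<Sum>j<k. (-1) ^ j * ((1 - fps_X ^ s) * ?H j)) * V = (\<Sum>j<k. (-1) ^ j * (((1 - fps_X ^ s) * V) * ?H j))"
      unfolding sum_distrib_right by (simp only: mult_ac)
    finally have "theta_fps r s k * V
        = ?A * V * euler_fps (\<lambda>i. r * Suc i) - (\<Sum>j<k. (-1) ^ j * (((1 - fps_X ^ s) * V) * ?H j))" .
    then have "(-1) ^ k * (theta_fps r s k * V) = E + (\<Sum>j<k. (-1) ^ (k + 1 + j) * (?G * ?H j))"
      unfolding DV V E_def by (simp add: right_diff_distrib sum_distrib_left power_add sum_negf mult.assoc)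
    also have "(\<Sum>j<k. (-1) ^ (k + 1 + j) * (?G * ?H j)) = (\<Sum>j<k. \<Sum>i<2 * j + 1. fps_const (w (j, i)) * fps_X ^ e (j, i) * ?G)"
      unfolding w_def e_def prod.case const sum_distrib_left by (simp only: mult_ac)
    also have "\<dots> = (\<Sum>t\<in>T. fps_const (w t) * fps_X ^ e t * ?G)"
      unfolding T_def by (subst sum.Sigma) (auto intro!: sum.cong)
    finally show ?thesis
      by (simp only: sum_distrib_right add.commute)
  qed
  moreover obtain K where K: "\<And>n. \<bar>((1 - fps_X) * two_parts x y) $ n\<bar> \<le> K"
    using two_parts_diff_bounded[OF xy cop] by blast
  moreover have "finite T"
    unfolding T_def by auto
  ultimately show ?thesis
    unfolding V_def[symmetric] using eventually_nonneg_combination[OF K _ w E, of e] by simp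
qed

theorem theorem1p4:
  fixes r s k :: nat
  assumes "coprime r s" and "1 \<le> s" and "2 * s < r" and "1 \<le> k"
  shows "\<exists>N::nat. \<forall>n\<ge>N. fps_nth (fps_expansion (truncated_quotient r s k) 0) n \<in> \<real>\<^sub>\<ge>\<^sub>0"
proof -
  have sr: "0 < s" "s < r" "0 < r - s" "0 < r" using assms by auto
  define D where "D = (euler_fps (\<lambda>i. s + r * i) * euler_fps (\<lambda>i. r - s + r * i) :: real fps)"
  \<comment> \<open>The real series whose complex image is shown to be the Taylor expansion.\<close>
  define F where "F = (-1) ^ k * (theta_fps r s k * inverse D)"
  have lt: "i < s + r * i" "i < r - s + r * i" for i
  proof -
    have "i \<le> r * i" using sr by simp
    then show "i < s + r * i" "i < r - s + r * i" using sr by linarith+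
  qed
  have D0: "D $ 0 = 1"
    using lt by (simp add: D_def)
  have "(\<lambda>q. (qpoch_inf (q ^ s) (q ^ r) * qpoch_inf (q ^ (r - s)) (q ^ r))) has_fps_expansion fps_of_real D"
    unfolding D_def fps_of_real_mult fps_of_real_euler_fps
    by (intro has_fps_expansion_mult qpoch_inf_has_fps_expansion sr)
  then have "(\<lambda>q. (-1) ^ k * (truncated_theta r s k q
       * inverse (qpoch_inf (q ^ s) (q ^ r) * qpoch_inf (q ^ (r - s)) (q ^ r))))
     has_fps_expansion fps_const ((-1) ^ k) * (theta_fps r s k * inverse (fps_of_real D))"
    using sr D0 by (intro fps_expansion_intros truncated_theta_has_fps_expansion) auto
  moreover have "(\<lambda>q. (-1) ^ k * (truncated_theta r s k q
       * inverse (qpoch_inf (q ^ s) (q ^ r) * qpoch_inf (q ^ (r - s)) (q ^ r)))) = truncated_quotient r s k"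
    by (simp add: fun_eq_iff truncated_quotient_def qpoch_inf_list_def divide_inverse)
  moreover have "fps_const ((-1) ^ k) * (theta_fps r s k * inverse (fps_of_real D)) = fps_of_real F"
  proof -
    have sgn: "fps_of_real ((-1) ^ k * G) = fps_const ((-1) ^ k) * fps_of_real G" for G
      by (rule fps_ext) (cases "even k"; simp)
    have D0': "D $ 0 \<noteq> 0" using D0 by simp
    show ?thesis
      unfolding F_def sgn unfolding fps_of_real_mult fps_of_real_theta_fps fps_of_real_inverse[OF D0'] by (rule refl)
  qed
  ultimately have "fps_expansion (truncated_quotient r s k) 0 = fps_of_real F"
    by (intro fps_expansion_eqI) simp
  moreover have "\<forall>\<^sub>F n in sequentially. 0 \<le> F $ n"
    unfolding F_def D_def by (rule eventually_quotient_nonneg[OF assms])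
  ultimately show ?thesis
    by (simp add: eventually_sequentially nonneg_Reals_of_real_iff)
qed

end
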